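(* Let $\beta>0$ and $0<\gamma\le 1$. For any density $p_Z$ on $[0,1]^{d_Z}$ satisfying $p_Z(z)\ge c$ for all $z$, where $c>0$ is some constant, we have $$\inf_{\hat p}\ \sup_{p\in\mathcal{P}_{\beta,\gamma}}\ \mathbb{E}_p\int\int|\hat p_{X|Z}(x|z)-p_{X|Z}(x|z)|\,p_Z(z)\,dx\,dz\ \gtrsim\ n^{\frac{-1}{\beta^{-1}d_X+\gamma^{-1}d_Z+2}},$$ where the supremum is over those $p\in\mathcal{P}_{\beta,\gamma}$ whose $Z$-marginal density is $p_Z$.
   Context: Setting: $X\in[0,1]^{d_X}$, $Z\in[0,1]^{d_Z}$ have a joint density $p=p_{X,Z}=p_{X|Z}\,p_Z$ with respect to Lebesgue measure on $[0,1]^{d_X+d_Z}$. An estimator $\hat p=\hat p_{X|Z}$ is any measurable function of $n$ i.i.d. samples $(X_1,Z_1),\dots,(X_n,Z_n)$ from $p$; $\mathbb{E}_p$ is the expectation over these samples; the infimum is over all estimators. Integrals in $x$ and $z$ are over $[0,1]^{d_X}$ and $[0,1]^{d_Z}$. The symbol $\gtrsim$ means inequality up to a positive multiplicative constant not depending on $n$ (it may depend on the fixed quantities $\beta,\gamma,d_X,d_Z,W_1,W_2,c$). The class $\mathcal{P}_{\beta,\gamma}$. $\lfloor\beta\rfloor$ is the greatest integer strictly less than $\beta$, and $\ell=\lfloor\beta\rfloor$. With fixed positive constants $W_1$ and (sufficiently large) $W_2$, $\mathcal{P}_{\beta,\gamma}$ is the class of such distributions for which: (Hölder smoothness in $x$)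 $p_{X|Z}(x|z)$ is $\ell$ times differentiable in $x$ and for all $x,x'\in[0,1]^{d_X}$, $z\in[0,1]^{d_Z}$ and multi-indices $\alpha\in\mathbb{N}_0^{d_X}$ with $\|\alpha\|_1=\ell$: $|D^\alpha p_{X|Z}(x|z)-D^\alpha p_{X|Z}(x'|z)|\le W_1\|x-x'\|_1^{\beta-\ell}$; ($\gamma$-TV smoothness in $z$) for all $z,z'\in[0,1]^{d_Z}$: $\|p_{X|Z=z}-p_{X|Z=z'}\|_1=\int|p_{X|Z}(x|z)-p_{X|Z}(x|z')|dx\le W_2\|z-z'\|_1^\gamma$. *)

theory Defs
  imports "HOL-Probability.Probability"
begin

abbreviation unit_cube :: "(real ^ 'n) set" where
  "unit_cube \<equiv> cbox 0 1"

definition l1_norm :: "real ^ 'n \<Rightarrow> real" where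
  "l1_norm v = (\<Sum>i\<in>UNIV. \<bar>v $ i\<bar>)"

text \<open>All derivatives are taken within \<open>S\<close>, hence are one-sided at boundary points of the cube.\<close>

definition partial_deriv ::
  "(real ^ 'n) set \<Rightarrow> 'n \<Rightarrow> (real ^ 'n \<Rightarrow> real) \<Rightarrow> real ^ 'n \<Rightarrow> real" where
  "partial_deriv S i f x = frechet_derivative f (at x within S) (axis i 1)"

primrec times_differentiable_on ::
  "nat \<Rightarrow> (real ^ 'n) set \<Rightarrow> (real ^ 'n \<Rightarrow> real) \<Rightarrow> bool" where
  "times_differentiable_on 0 S f \<longleftrightarrow> True"
| "times_differentiable_on (Suc k) S f \<longleftrightarrow>
     f differentiable_on S \<and> (\<forall>i. times_differentiable_on k S (partial_deriv S i f))"

text \<open>\<open>D\<^sup>\<alpha> f\<close>: the coordinate \<open>i\<close> is differentiated \<open>\<alpha> i\<close> times.  The order of differentiation is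
  fixed arbitrarily; by symmetry of second derivatives it does not matter for functions that are
  \<open>\<Sum>\<^sub>i \<alpha> i\<close> times (Frechet) differentiable, the only ones it is applied to.\<close>

definition multi_deriv ::
  "(real ^ 'n) set \<Rightarrow> ('n \<Rightarrow> nat) \<Rightarrow> (real ^ 'n \<Rightarrow> real) \<Rightarrow> real ^ 'n \<Rightarrow> real" where
  "multi_deriv S \<alpha> f = foldr (partial_deriv S) (SOME js. \<forall>i. count_list js i = \<alpha> i) f"

text \<open>The greatest integer \<^emph>\<open>strictly\<close> less than \<open>\<beta>\<close>, for \<open>\<beta> > 0\<close>; so it is \<open>\<beta> - 1\<close> for integral \<open>\<beta>\<close>.\<close>

definition strict_floor :: "real \<Rightarrow> nat" where
  "strict_floor \<beta> = (GREATEST k. real k < \<beta>)"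

definition prob_density_on :: "'a::euclidean_space set \<Rightarrow> ('a \<Rightarrow> real) \<Rightarrow> bool" where
  "prob_density_on S f \<longleftrightarrow>
     set_borel_measurable borel S f \<and> (\<forall>x\<in>S. 0 \<le> f x) \<and>
     (\<integral>\<^sup>+x\<in>S. ennreal (f x) \<partial>lborel) = 1"

text \<open>Conditional densities \<open>p\<^bsub>X|Z\<^esub>(x|z)\<close> are curried functions \<open>q x z\<close>.\<close>

definition conditional_density :: "(real ^ 'dx \<Rightarrow> real ^ 'dz \<Rightarrow> real) \<Rightarrow> bool" where
  "conditional_density q \<longleftrightarrow>
     set_borel_measurable borel (unit_cube \<times> unit_cube) (\<lambda>(x, z). q x z) \<and>
     (\<forall>z\<in>unit_cube. prob_density_on unit_cube (\<lambda>x. q x z))"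

definition holder_smooth :: "real \<Rightarrow> real \<Rightarrow> (real ^ 'dx \<Rightarrow> real ^ 'dz \<Rightarrow> real) \<Rightarrow> bool" where
  "holder_smooth \<beta> W\<^sub>1 q \<longleftrightarrow>
     (\<forall>z\<in>unit_cube.
        times_differentiable_on (strict_floor \<beta>) unit_cube (\<lambda>x. q x z) \<and>
        (\<forall>x\<in>unit_cube. \<forall>x'\<in>unit_cube. \<forall>\<alpha>. (\<Sum>i\<in>UNIV. \<alpha> i) = strict_floor \<beta> \<longrightarrow>
           \<bar>multi_deriv unit_cube \<alpha> (\<lambda>x. q x z) x - multi_deriv unit_cube \<alpha> (\<lambda>x. q x z) x'\<bar>
             \<le> W\<^sub>1 * l1_norm (x - x') powr (\<beta> - real (strict_floor \<beta>))))"

definition tv_smooth :: "real \<Rightarrow> real \<Rightarrow> (real ^ 'dx \<Rightarrow> real ^ 'dz \<Rightarrow> real) \<Rightarrow> bool" where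
  "tv_smooth \<gamma> W\<^sub>2 q \<longleftrightarrow>
     (\<forall>z\<in>unit_cube. \<forall>z'\<in>unit_cube.
        (\<integral>\<^sup>+x\<in>unit_cube. ennreal \<bar>q x z - q x z'\<bar> \<partial>lborel)
          \<le> ennreal (W\<^sub>2 * l1_norm (z - z') powr \<gamma>))"

text \<open>A distribution of \<open>(X, Z)\<close> is represented by the pair \<open>(p\<^bsub>X|Z\<^esub>, p\<^sub>Z)\<close>, its joint density being
  the product.  Keeping the conditional density, rather than the quotient \<open>p\<^bsub>X,Z\<^esub> / p\<^sub>Z\<close>, makes the
  smoothness conditions at every \<open>z\<close> meaningful where \<open>p\<^sub>Z\<close> vanishes.\<close>

definition smooth_class ::
  "real \<Rightarrow> real \<Rightarrow> real \<Rightarrow> real \<Rightarrow> ((real ^ 'dx \<Rightarrow> real ^ 'dz \<Rightarrow> real) \<times> (real ^ 'dz \<Rightarrow> real)) set" where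
  "smooth_class \<beta> \<gamma> W\<^sub>1 W\<^sub>2 =
     {(q, p\<^sub>Z). conditional_density q \<and> prob_density_on unit_cube p\<^sub>Z \<and>
               holder_smooth \<beta> W\<^sub>1 q \<and> tv_smooth \<gamma> W\<^sub>2 q}"

definition joint_law ::
  "(real ^ 'dx \<Rightarrow> real ^ 'dz \<Rightarrow> real) \<Rightarrow> (real ^ 'dz \<Rightarrow> real) \<Rightarrow> ((real ^ 'dx) \<times> (real ^ 'dz)) measure" where
  "joint_law q p\<^sub>Z =
     density lborel (\<lambda>(x, z). ennreal (q x z * p\<^sub>Z z) * indicator (unit_cube \<times> unit_cube) (x, z))"

type_synonym ('dx, 'dz) estimator =
  "(nat \<Rightarrow> (real ^ 'dx) \<times> (real ^ 'dz)) \<Rightarrow> real ^ 'dx \<Rightarrow> real ^ 'dz \<Rightarrow> real"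

text \<open>Measurable jointly in the samples and the evaluation point.  Estimates need not be
  probability densities.\<close>

definition estimators :: "nat \<Rightarrow> ('dx::finite, 'dz::finite) estimator set" where
  "estimators n =
     {p_hat. (\<lambda>(s, x, z). p_hat s x z) \<in>
        borel_measurable ((\<Pi>\<^sub>M i\<in>{..<n}. borel) \<Otimes>\<^sub>M borel \<Otimes>\<^sub>M borel)}"

definition risk ::
  "nat \<Rightarrow> ('dx::finite, 'dz::finite) estimator \<Rightarrow>
     (real ^ 'dx \<Rightarrow> real ^ 'dz \<Rightarrow> real) \<Rightarrow> (real ^ 'dz \<Rightarrow> real) \<Rightarrow> ennreal" where
  "risk n p_hat q p\<^sub>Z =
     (\<integral>\<^sup>+s. (\<integral>\<^sup>+z\<in>unit_cube. (\<integral>\<^sup>+x\<in>unit_cube.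
          ennreal (\<bar>p_hat s x z - q x z\<bar> * p\<^sub>Z z) \<partial>lborel) \<partial>lborel)
        \<partial>(\<Pi>\<^sub>M i\<in>{..<n}. joint_law q p\<^sub>Z))"

end

theory Submission
  imports Defs "HOL-Computational_Algebra.Polynomial" "HOL-Library.Multiset"
begin

text \<open>The lower bound is an instance of Assouad's method.  Let \<open>P\<close> be the law under which \<open>X\<close> is
  uniform on the cube and independent of \<open>Z\<close>, whose density is \<open>p\<^sub>Z\<close>.  Cut the \<open>x\<close>-cube into cells of
  side \<open>1/N\<close> and the \<open>z\<close>-cube into cells of side \<open>1/K\<close>, and put on every product cell \<open>e = (i, j)\<close> the
  bump \<open>u\<^sub>e(x, z) = h \<phi>\<^sub>i(x) \<psi>\<^sub>j(z)\<close>.  Here \<open>\<phi>\<^sub>i\<close> and \<open>\<psi>\<^sub>j\<close> are rescaled copies of products of one smooth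
  bump on the line with mean zero, so that every \<open>q\<^sub>A = 1 + (\<Sum>e\<in>A. u\<^sub>e)\<close> is a conditional density.
  Differentiating \<open>\<phi>\<^sub>i\<close> in \<open>x\<close> costs powers of \<open>N\<close>, so the Hoelder condition holds for \<open>h = a N\<^sup>-\<^sup>\<beta>\<close> with
  a small constant \<open>a\<close>.  The total variation condition in \<open>z\<close> asks for \<open>h K\<^sup>\<gamma>\<close> to be bounded; hence
  \<open>N\<^sup>-\<^sup>\<beta>\<close> and \<open>K\<^sup>-\<^sup>\<gamma>\<close> are taken of the same order.

  The densities \<open>q\<^sub>A\<close> and \<open>q\<^sub>A + u\<^sub>e\<close> cannot be told apart from \<open>n\<close> samples as long as
  \<open>n \<integral> u\<^sub>e\<^sup>2 dP \<le> 1\<close>: their Hellinger affinity is at least \<open>1 - 1/(2n)\<close>, it is multiplicative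
  over the samples, and so the two sample laws overlap in mass at least \<open>1/8\<close>
  (\<open>nn_integral_min_product_density_ge\<close>).  On the overlap, the errors that an estimator makes on the
  cell \<open>e\<close> for the two densities sum to at least \<open>\<integral> \<bar>u\<^sub>e\<bar> dP\<close>.  Averaging over all \<open>A\<close>, these errors add up over the disjoint cells
  (\<open>assouad_perturbed_density\<close>), to the order of \<open>h\<close> in total.

  The density \<open>p\<^sub>Z\<close> is bounded below but not above, and a \<open>z\<close>-cell carrying much mass would make
  \<open>\<integral> u\<^sub>e\<^sup>2 dP\<close> too large.  By Markov's inequality at least half of the \<open>K\<^sup>d\<close> cells (\<open>d\<close> the dimension
  of \<open>z\<close>) have mass at most \<open>2 / K\<^sup>d\<close>, and only those are perturbed; the bound \<open>p\<^sub>Z \<ge> c\<close> ensures that an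
  error on such a cell is charged proportionally to its volume (\<open>risk_lower_bound\<close>).  What remains is to
  take \<open>N\<close> and \<open>K\<close> with \<open>N\<^sup>\<beta>\<close> and \<open>K\<^sup>\<gamma>\<close> of the order of the \<open>D\<close>-th root of \<open>n\<close>, where \<open>D\<close> is the
  denominator in the exponent of the rate; this makes \<open>n \<integral> u\<^sub>e\<^sup>2 dP\<close> of order one
  (\<open>grid_sizes_exist\<close>).\<close>

section \<open>Overlap of two product laws with nearby densities\<close>

text \<open>Integrated, this bounds the Hellinger affinity of two densities from below by one minus half their
  squared \<open>L\<^sup>2\<close> distance.  With \<open>m = (a + b)/2\<close> and \<open>d = (a - b)/2\<close> the product is \<open>m\<^sup>2 - d\<^sup>2\<close>, and
  \<open>m - 2d\<^sup>2 \<le> sqrt (m\<^sup>2 - d\<^sup>2)\<close> because \<open>m \<ge> 1/2\<close>.\<close>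

lemma sqrt_mult_ge_average:
  fixes a b :: real
  assumes "1/2 \<le> a" "1/2 \<le> b"
  shows "(a + b) / 2 - (a - b)\<^sup>2 / 2 \<le> sqrt (a * b)"
proof (cases "(a + b) / 2 - (a - b)\<^sup>2 / 2 \<le> 0")
  case True
  have "0 \<le> sqrt (a * b)" using assms by simp
  with True show ?thesis by linarith
next
  case False
  define m where "m = (a + b) / 2"
  define w where "w = (a - b)\<^sup>2 / 4"
  have ab: "a * b = m\<^sup>2 - w"
    by (simp add: m_def w_def field_simps power2_eq_square)
  have m: "1/2 \<le> m" using assms by (simp add: m_def)
  have w: "0 \<le> w" "2 * w < m" using False by (auto simp: m_def w_def)
  have "0 \<le> w * (4 * m - 1 - 4 * w)" using m w by (intro mult_nonneg_nonneg) auto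
  then have "(m - 2 * w)\<^sup>2 \<le> a * b"
    unfolding ab by (simp add: field_simps power2_eq_square)
  then have "m - 2 * w \<le> sqrt (a * b)" by (rule real_le_rsqrt)
  then show ?thesis by (simp add: m_def w_def)
qed

text \<open>A large affinity forces a large overlap \<open>\<integral> min f g\<close>: as \<open>f g = min f g * max f g\<close>, the weighted
  inequality between the geometric and the arithmetic mean applies.  The weight is such that the error term
  integrates to \<open>1/4\<close> for probability densities, which is below the affinity \<open>1/2\<close> met later.\<close>

lemma sqrt_mult_le_min_plus:
  fixes f g :: real
  assumes "0 \<le> f" "0 \<le> g"
  shows "sqrt (f * g) \<le> 2 * min f g + (f + g) / 8"
proof (rule real_le_lsqrt)
  define a b where "a = min f g" and "b = max f g"
  have fg: "f * g = a * b" "f + g = a + b" by (auto simp: a_def b_def min_def max_def)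
  have "(2 * a + (a + b) / 8)\<^sup>2 - a * b = (2 * a - b / 8)\<^sup>2 + 33/64 * (a * a) + 1/32 * (a * b)"
    by (simp add: field_simps power2_eq_square)
  also have "\<dots> \<ge> 0" using assms by (intro add_nonneg_nonneg) (auto simp: a_def b_def)
  finally have "a * b \<le> (2 * a + (a + b) / 8)\<^sup>2" by simp
  then show "f * g \<le> (2 * min f g + (f + g) / 8)\<^sup>2" by (simp add: fg flip: a_def)
qed (use assms in auto)

lemma PiM_density:
  assumes "prob_space M" "finite I"
    and f[measurable]: "f \<in> borel_measurable M" and f1: "(\<integral>\<^sup>+t. f t \<partial>M) = 1"
  shows "(\<Pi>\<^sub>M i\<in>I. density M f) = density (\<Pi>\<^sub>M i\<in>I. M) (\<lambda>s. \<Prod>i\<in>I. f (s i))"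
proof -
  interpret M: prob_space M by fact
  interpret D: prob_space "density M f"
    by standard (simp add: emeasure_density f1)
  interpret PM: product_sigma_finite "\<lambda>_. M" by standard
  interpret PD: product_sigma_finite "\<lambda>_. density M f" by standard
  have "density (\<Pi>\<^sub>M i\<in>I. M) (\<lambda>s. \<Prod>i\<in>I. f (s i)) = (\<Pi>\<^sub>M i\<in>I. density M f)"
  proof (rule PD.PiM_eqI)
    show "finite I" by fact
    show "sets (density (\<Pi>\<^sub>M i\<in>I. M) (\<lambda>s. \<Prod>i\<in>I. f (s i))) = sets (\<Pi>\<^sub>M i\<in>I. density M f)"
      by (simp cong: sets_PiM_cong)
  next
    fix B assume "\<And>i. i \<in> I \<Longrightarrow> B i \<in> sets (density M f)"
    then have B[measurable]: "\<And>i. i \<in> I \<Longrightarrow> B i \<in> sets M" by simp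
    have PB: "Pi\<^sub>E I B \<in> sets (\<Pi>\<^sub>M i\<in>I. M)" using B \<open>finite I\<close> by (intro sets_PiM_I_finite)
    have "emeasure (density (\<Pi>\<^sub>M i\<in>I. M) (\<lambda>s. \<Prod>i\<in>I. f (s i))) (Pi\<^sub>E I B) =
        (\<integral>\<^sup>+s. (\<Prod>i\<in>I. f (s i)) * indicator (Pi\<^sub>E I B) s \<partial>(\<Pi>\<^sub>M i\<in>I. M))"
      using PB by (intro emeasure_density) auto
    also have "\<dots> = (\<integral>\<^sup>+s. (\<Prod>i\<in>I. f (s i) * indicator (B i) (s i)) \<partial>(\<Pi>\<^sub>M i\<in>I. M))"
    proof (intro nn_integral_cong)
      fix s assume s: "s \<in> space (\<Pi>\<^sub>M i\<in>I. M)"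
      then have "indicator (Pi\<^sub>E I B) s = (\<Prod>i\<in>I. indicator (B i) (s i) :: ennreal)"
        using \<open>finite I\<close> by (auto simp: indicator_def space_PiM PiE_def Pi_iff prod_zero_iff)
      then show "(\<Prod>i\<in>I. f (s i)) * indicator (Pi\<^sub>E I B) s = (\<Prod>i\<in>I. f (s i) * indicator (B i) (s i))"
        by (simp add: prod.distrib)
    qed
    also have "\<dots> = (\<Prod>i\<in>I. \<integral>\<^sup>+t. f t * indicator (B i) t \<partial>M)"
      using \<open>finite I\<close> by (intro PM.product_nn_integral_prod) auto
    also have "\<dots> = (\<Prod>i\<in>I. emeasure (density M f) (B i))"
      using B by (intro prod.cong refl emeasure_density[symmetric]) auto
    finally show "emeasure (density (\<Pi>\<^sub>M i\<in>I. M) (\<lambda>s. \<Prod>i\<in>I. f (s i))) (Pi\<^sub>E I B) =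
        (\<Prod>i\<in>I. emeasure (density M f) (B i))" .
  qed
  then show ?thesis by simp
qed

lemma nn_integral_lincomb:
  fixes f g :: "'a \<Rightarrow> real"
  assumes [measurable]: "f \<in> borel_measurable M" "g \<in> borel_measurable M"
    and "\<And>t. 0 \<le> f t" "\<And>t. 0 \<le> g t" "0 \<le> a" "0 \<le> b"
  shows "(\<integral>\<^sup>+t. ennreal (a * f t + b * g t) \<partial>M) =
    ennreal a * (\<integral>\<^sup>+t. ennreal (f t) \<partial>M) + ennreal b * (\<integral>\<^sup>+t. ennreal (g t) \<partial>M)"
  using assms by (simp add: ennreal_plus ennreal_mult nn_integral_add nn_integral_cmult)

text \<open>The affinity of the product laws is the \<open>n\<close>-th power of that of \<open>f\<close> and \<open>g\<close>.  The latter is at least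
  \<open>1 - 1/(2n)\<close>, so Bernoulli's inequality leaves \<open>1/2\<close>, and \<open>1/2 \<le> 2 \<integral> min + 1/4\<close> gives the overlap.\<close>

lemma nn_integral_min_product_density_ge:
  assumes "prob_space M" "1 \<le> n"
    and [measurable]: "f \<in> borel_measurable M" "g \<in> borel_measurable M"
    and f: "\<And>t. 1/2 \<le> f t" and g: "\<And>t. 1/2 \<le> g t"
    and f1: "(\<integral>\<^sup>+t. ennreal (f t) \<partial>M) = 1" and g1: "(\<integral>\<^sup>+t. ennreal (g t) \<partial>M) = 1"
    and d: "of_nat n * (\<integral>\<^sup>+t. ennreal ((f t - g t)\<^sup>2) \<partial>M) \<le> 1"
  shows "1 \<le> 8 * (\<integral>\<^sup>+s. ennreal (min (\<Prod>i<n. f (s i)) (\<Prod>i<n. g (s i))) \<partial>(\<Pi>\<^sub>M i\<in>{..<n}. M))"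
proof -
  interpret M: prob_space M by fact
  interpret PM: product_sigma_finite "\<lambda>_. M" by standard
  let ?N = "\<Pi>\<^sub>M i\<in>{..<n}. M"
  have f0: "0 \<le> f t" and g0: "0 \<le> g t" for t using f[of t] g[of t] by auto
  let ?F = "\<lambda>s. \<Prod>i<n. f (s i)" and ?G = "\<lambda>s. \<Prod>i<n. g (s i)"
  have F0: "0 \<le> ?F s" and G0: "0 \<le> ?G s" for s using f0 g0 by (auto intro: prod_nonneg)
  have F1: "(\<integral>\<^sup>+s. ennreal (?F s) \<partial>?N) = 1"
    using PM.product_nn_integral_prod[of "{..<n}" "\<lambda>_ t. ennreal (f t)"]
    by (simp add: prod_ennreal f0 f1)
  have G1: "(\<integral>\<^sup>+s. ennreal (?G s) \<partial>?N) = 1"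
    using PM.product_nn_integral_prod[of "{..<n}" "\<lambda>_ t. ennreal (g t)"]
    by (simp add: prod_ennreal g0 g1)
  define r where "r = (\<integral>\<^sup>+t. ennreal (sqrt (f t * g t)) \<partial>M)"
  define D where "D = (\<integral>\<^sup>+t. ennreal ((f t - g t)\<^sup>2) \<partial>M)"
  define m where "m = (\<integral>\<^sup>+s. ennreal (min (?F s) (?G s)) \<partial>?N)"
  have "1 = ennreal (1/2) * 1 + ennreal (1/2) * 1"
    by (simp only: mult_1_right flip: ennreal_plus) simp
  also have "\<dots> = (\<integral>\<^sup>+t. ennreal (1/2 * f t + 1/2 * g t) \<partial>M)"
    using f0 g0 by (subst nn_integral_lincomb) (auto simp: f1 g1)
  also have "\<dots> \<le> (\<integral>\<^sup>+t. ennreal (1 * sqrt (f t * g t) + 1/2 * (f t - g t)\<^sup>2) \<partial>M)"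
    using sqrt_mult_ge_average[OF f g]
    by (intro nn_integral_mono ennreal_leI) (simp add: field_simps)
  also have "\<dots> = r + ennreal (1/2) * D"
    using f0 g0 by (subst nn_integral_lincomb) (auto simp: r_def D_def)
  finally have rD: "1 \<le> r + ennreal (1/2) * D" .
  have "r \<le> (\<integral>\<^sup>+t. ennreal (f t + g t) \<partial>M)"
    unfolding r_def
  proof (intro nn_integral_mono ennreal_leI)
    fix t
    have "0 \<le> f t * g t" "0 \<le> f t * f t"  "0 \<le> g t * g t" using f0 g0 by auto
    then show "sqrt (f t * g t) \<le> f t + g t" using f0[of t] g0[of t]
      by (intro real_le_lsqrt) (auto simp: power2_eq_square field_simps)
  qed
  also have "\<dots> = 2" by (simp add: ennreal_plus f0 g0 nn_integral_add f1 g1)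
  finally have r2: "r \<le> 2" .
  then obtain r' where r': "r = ennreal r'" "0 \<le> r'"
    by (cases r) (auto simp: top_unique)
  have "D \<noteq> top" using d \<open>1 \<le> n\<close> unfolding D_def[symmetric]
    by (auto simp: ennreal_mult_top ennreal_top_mult top_unique split: if_splits)
  then obtain D' where D': "D = ennreal D'" "0 \<le> D'" by (cases D) auto
  have 1: "real n * D' \<le> 1"
    using d unfolding D_def[symmetric] D'
        by (simp add: D'(2) ennreal_of_nat_eq_real_of_nat flip: ennreal_mult)
  have "r + ennreal (1/2) * D = ennreal (r' + 1/2 * D')"
    unfolding r' D' using r'(2) D'(2) by (simp only: ennreal_plus ennreal_mult mult_nonneg_nonneg)
  then have "1 \<le> r' + D' / 2"
    using rD by (simp only: ennreal_1[symmetric] ennreal_le_iff2) auto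
  moreover have "D' \<le> 1 / real n" using 1 \<open>1 \<le> n\<close> by (simp add: field_simps)
  moreover have "1 / (2 * real n) = 1 / real n / 2" by simp
  ultimately have 2: "1 - 1 / (2 * real n) \<le> r'" by linarith
  \<comment> \<open>Bernoulli: the left-hand side is \<open>1/2\<close>.\<close>
  have "1 + real n * (- 1 / (2 * real n)) \<le> (1 + (- 1 / (2 * real n))) ^ n"
    using \<open>1 \<le> n\<close> by (intro Bernoulli_inequality) (simp add: field_simps)
  also have "\<dots> \<le> r' ^ n" using 2 \<open>1 \<le> n\<close> by (intro power_mono) (auto simp: field_simps)
  finally have rn: "1/2 \<le> r' ^ n" using \<open>1 \<le> n\<close> by simp
  have "ennreal (r' ^ n) = r ^ n" by (simp add: r' ennreal_power)
  also have "\<dots> = (\<integral>\<^sup>+s. (\<Prod>i<n. ennreal (sqrt (f (s i) * g (s i)))) \<partial>?N)"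
    unfolding r_def by (subst PM.product_nn_integral_prod) auto
  also have "\<dots> = (\<integral>\<^sup>+s. ennreal (sqrt (?F s * ?G s)) \<partial>?N)"
  proof -
    have "(\<Prod>i<n. sqrt (f (s i) * g (s i))) = sqrt (?F s * ?G s)" for s
      by (induction n) (simp_all add: real_sqrt_mult)
    then show ?thesis using f0 g0 by (subst prod_ennreal) auto
  qed
  also have "\<dots> \<le> (\<integral>\<^sup>+s. ennreal (2 * min (?F s) (?G s) + 1 * (1/8 * ?F s + 1/8 * ?G s)) \<partial>?N)"
    using sqrt_mult_le_min_plus[OF F0 G0]
    by (intro nn_integral_mono ennreal_leI) (simp add: field_simps)
  also have "\<dots> = 2 * m + (\<integral>\<^sup>+s. ennreal (1/8 * ?F s + 1/8 * ?G s) \<partial>?N)"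
    using F0 G0 by (subst nn_integral_lincomb) (auto simp: m_def)
  also have "\<dots> = 2 * m + (ennreal (1/8) * 1 + ennreal (1/8) * 1)"
    using F0 G0 by (subst nn_integral_lincomb) (auto simp: F1 G1)
  also have "\<dots> = 2 * m + ennreal (1/4)"
    by (simp only: mult_1_right flip: ennreal_plus) simp
  finally have 3: "ennreal (r' ^ n) \<le> 2 * m + ennreal (1/4)" .
  have "1 \<le> 8 * m"
  proof (cases m)
    case (real m')
    then have "ennreal (r' ^ n) \<le> ennreal (2 * m' + 1/4)" using 3
        by (simp add: ennreal_plus ennreal_mult')
    then have "r' ^ n \<le> 2 * m' + 1/4" using real by (subst (asm) ennreal_le_iff) auto
    then have "ennreal 1 \<le> ennreal (8 * m')" using rn by (intro ennreal_leI) simp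
    then show ?thesis using real by (simp add: ennreal_mult')
  qed (simp add: ennreal_mult_top)
  then show ?thesis by (simp add: m_def)
qed

section \<open>Assouad's lemma for disjointly supported perturbations\<close>

text \<open>The edges of the hypercube \<open>Pow E\<close> in direction \<open>e\<close> form a perfect matching of its vertices.\<close>

lemma sum_Pow_split:
  assumes "finite E" "e \<in> E"
  shows "(\<Sum>A\<in>Pow E. h A) = (\<Sum>A\<in>Pow (E - {e}). h A + h (insert e A))"
proof -
  have E: "Pow E = Pow (E - {e}) \<union> insert e ` Pow (E - {e})"
    using assms(2) by (metis Pow_insert insert_Diff)
  have inj: "inj_on (insert e) (Pow (E - {e}))"
    by (auto simp: inj_on_def)
  have "sum h (Pow E) = sum h (Pow (E - {e})) + sum h (insert e ` Pow (E - {e}))"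
    using assms(1) by (subst E, intro sum.union_disjoint) auto
  then show ?thesis by (simp add: sum.reindex[OF inj] sum.distrib)
qed

definition perturbed :: "('e \<Rightarrow> 't \<Rightarrow> real) \<Rightarrow> 'e set \<Rightarrow> 't \<Rightarrow> real" where
  "perturbed u A t = 1 + (\<Sum>e\<in>A. u e t)"

lemma perturbed_insert:
  "finite A \<Longrightarrow> e \<notin> A \<Longrightarrow> perturbed u (insert e A) t = perturbed u A t + u e t"
  by (simp add: perturbed_def)

lemma abs_sum_disjoint_le:
  fixes u :: "'e \<Rightarrow> real"
  assumes "\<And>e e'. e \<in> A \<Longrightarrow> e' \<in> A \<Longrightarrow> e \<noteq> e' \<Longrightarrow> u e = 0 \<or> u e' = 0"
    and "\<And>e. e \<in> A \<Longrightarrow> \<bar>u e\<bar> \<le> B" "0 \<le> B"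
  shows "\<bar>\<Sum>e\<in>A. u e\<bar> \<le> B"
proof (cases "finite A \<and> (\<exists>e\<in>A. u e \<noteq> 0)")
  case True
  then obtain e where e: "e \<in> A" "u e \<noteq> 0" by auto
  then have "(\<Sum>e\<in>A. u e) = (\<Sum>e\<in>{e}. u e)"
    using True assms(1)[of e] by (intro sum.mono_neutral_right) auto
  then show ?thesis using assms(2) e by auto
next
  case False
  then have "(\<Sum>e\<in>A. u e) = 0" by (cases "finite A") auto
  then show ?thesis using assms(3) by simp
qed

text \<open>The loss is at least the sum of its restrictions to the disjoint sets \<open>{t. u e t \<noteq> 0}\<close>.  On such a set
  the densities indexed by \<open>A\<close> and \<open>insert e A\<close> differ by \<open>u e\<close>, so by the triangle inequality one sample
  cannot be good for both: the two losses sum to at least \<open>\<integral> \<bar>u e\<bar>\<close>, weighted by the overlap \<open>1/8\<close> of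
  the two sample laws.  Matching the vertices along the direction \<open>e\<close> yields \<open>\<delta> / 16\<close> for the average over
  the hypercube, for each \<open>e\<close>, and the worst vertex is at least as bad as the average.\<close>

theorem assouad_perturbed_density:
  fixes M :: "'t measure" and u :: "'e \<Rightarrow> 't \<Rightarrow> real" and g :: "(nat \<Rightarrow> 't) \<Rightarrow> 't \<Rightarrow> real"
  assumes "prob_space M" "finite E" "1 \<le> n"
    and u_meas: "\<And>e. e \<in> E \<Longrightarrow> u e \<in> borel_measurable M"
    and disj: "\<And>e e' t. e \<in> E \<Longrightarrow> e' \<in> E \<Longrightarrow> e \<noteq> e' \<Longrightarrow> u e t = 0 \<or> u e' t = 0"
    and bound: "\<And>e t. e \<in> E \<Longrightarrow> \<bar>u e t\<bar> \<le> 1/2"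
    and mass: "\<And>A. A \<subseteq> E \<Longrightarrow> (\<integral>\<^sup>+t. ennreal (perturbed u A t) \<partial>M) = 1"
    and chi: "\<And>e. e \<in> E \<Longrightarrow> of_nat n * (\<integral>\<^sup>+t. ennreal ((u e t)\<^sup>2) \<partial>M) \<le> 1"
    and sep: "\<And>e. e \<in> E \<Longrightarrow> \<delta> \<le> (\<integral>\<^sup>+t. ennreal \<bar>u e t\<bar> \<partial>M)"
    and g_meas: "(\<lambda>(s, t). g s t) \<in> borel_measurable ((\<Pi>\<^sub>M i\<in>{..<n}. M) \<Otimes>\<^sub>M M)"
  shows "\<exists>A\<subseteq>E. of_nat (card E) * \<delta> \<le> 16 *
    (\<integral>\<^sup>+s. (\<integral>\<^sup>+t. ennreal \<bar>g s t - perturbed u A t\<bar> \<partial>M) \<partial>(\<Pi>\<^sub>M i\<in>{..<n}. density M (\<lambda>t. ennreal (perturbed u A t))))"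
proof -
  interpret M: prob_space M by fact
  interpret PM: product_sigma_finite "\<lambda>_. M" by standard
  let ?N = "\<Pi>\<^sub>M i\<in>{..<n}. M"
  let ?q = "perturbed u"
  have fin: "finite A" if "A \<subseteq> E" for A using that \<open>finite E\<close> finite_subset by auto
  have q_meas: "?q A \<in> borel_measurable M" if "A \<subseteq> E" for A
    unfolding perturbed_def using u_meas that
        by (auto intro!: borel_measurable_add borel_measurable_sum)
  have q_ge: "1/2 \<le> ?q A t" if "A \<subseteq> E" for A t
  proof -
    have "\<bar>\<Sum>e\<in>A. u e t\<bar> \<le> 1/2"
      using that disj bound by (intro abs_sum_disjoint_le) (blast, blast, simp)
    then show ?thesis unfolding perturbed_def by linarith
  qed
  have q0: "0 \<le> ?q A t" if "A \<subseteq> E" for A t using q_ge[OF that, of t] by simp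
  define F where "F A s = (\<Prod>i<n. ?q A (s i))" for A s
  have F_meas: "F A \<in> borel_measurable ?N" if "A \<subseteq> E" for A
    unfolding F_def using q_meas[OF that] by measurable
  have F0: "0 \<le> F A s" if "A \<subseteq> E" for A s unfolding F_def using q0[OF that] by (intro prod_nonneg) auto
  \<comment> \<open>\<open>L A e\<close> is the risk at the vertex \<open>A\<close> that is incurred on the
    support of \<open>u e\<close>, \<open>R A\<close> the whole risk at \<open>A\<close>.\<close>
  define l where "l A e s = (\<integral>\<^sup>+t. ennreal (\<bar>g s t - ?q A t\<bar>) * indicator {t. u e t \<noteq> 0} t \<partial>M)" for A e s
  define R where "R A =
      (\<integral>\<^sup>+s. (\<integral>\<^sup>+t. ennreal \<bar>g s t - ?q A t\<bar> \<partial>M) \<partial>(\<Pi>\<^sub>M i\<in>{..<n}. density M (\<lambda>t. ennreal (?q A t))))" for A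
  define L where "L A e = (\<integral>\<^sup>+s. ennreal (F A s) * l A e s \<partial>?N)" for A e
  have g2_meas: "(\<lambda>(s, t). ennreal (\<bar>g s t - ?q A t\<bar>)) \<in> borel_measurable (?N \<Otimes>\<^sub>M M)" if "A \<subseteq> E" for A
    using g_meas q_meas[OF that] by measurable
  have l_meas: "l A e \<in> borel_measurable ?N" if "A \<subseteq> E" "e \<in> E" for A e
  proof -
    have [measurable]: "u e \<in> borel_measurable M" using u_meas that by auto
    have [measurable]: "(\<lambda>(s, t). ennreal (\<bar>g s t - ?q A t\<bar>)) \<in> borel_measurable (?N \<Otimes>\<^sub>M M)"
      using g2_meas that by auto
    have [measurable]: "{t\<in>space M. u e t \<noteq> 0} \<in> sets M" by measurable
    have "(\<lambda>s. \<integral>\<^sup>+t. ennreal (\<bar>g s t - ?q A t\<bar>) *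
        indicator {t\<in>space M. u e t \<noteq> 0} t \<partial>M) \<in> borel_measurable ?N"
      by measurable
    also have "(\<lambda>s. \<integral>\<^sup>+t. ennreal (\<bar>g s t - ?q A t\<bar>) * indicator {t\<in>space M. u e t \<noteq> 0} t \<partial>M) = l A e"
      unfolding l_def by (intro ext nn_integral_cong) (auto simp: indicator_def)
    finally show ?thesis .
  qed
  have R_ge: "(\<Sum>e\<in>E. L A e) \<le> R A" if A: "A \<subseteq> E" for A
  proof -
    have "(\<Sum>e\<in>E. L A e) = (\<integral>\<^sup>+s. ennreal (F A s) * (\<Sum>e\<in>E. l A e s) \<partial>?N)"
      unfolding L_def using F_meas[OF A] l_meas[OF A]
      by (subst nn_integral_sum[symmetric]) (auto simp: sum_distrib_left)
    also have "\<dots> \<le> (\<integral>\<^sup>+s. ennreal (F A s) * (\<integral>\<^sup>+t. ennreal \<bar>g s t - ?q A t\<bar> \<partial>M) \<partial>?N)"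
    proof (intro nn_integral_mono mult_left_mono)
      fix s assume s: "s \<in> space ?N"
      have gs: "(\<lambda>t. ennreal \<bar>g s t - ?q A t\<bar>) \<in> borel_measurable M"
        using measurable_compose[OF measurable_Pair1'[OF s] g2_meas[OF A]] by simp
      have "(\<lambda>t. ennreal (\<bar>g s t - ?q A t\<bar>) * indicator {t. u e t \<noteq> 0} t) \<in> borel_measurable M"
          if "e \<in> E" for e
      proof -
        have [measurable]: "u e \<in> borel_measurable M" using u_meas that by auto
        have "(\<lambda>t. ennreal (\<bar>g s t - ?q A t\<bar>) *
            indicator {t\<in>space M. u e t \<noteq> 0} t) \<in> borel_measurable M"
          using gs by measurable
        then show ?thesis
          by (rule measurable_cong[THEN iffD1, rotated]) (auto simp: indicator_def)
      qed
      then have "(\<Sum>e\<in>E. l A e s) =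
          (\<integral>\<^sup>+t. (\<Sum>e\<in>E. ennreal (\<bar>g s t - ?q A t\<bar>) * indicator {t. u e t \<noteq> 0} t) \<partial>M)"
        unfolding l_def by (intro nn_integral_sum[symmetric]) auto
      also have "\<dots> \<le> (\<integral>\<^sup>+t. ennreal \<bar>g s t - ?q A t\<bar> \<partial>M)"
      proof (intro nn_integral_mono)
        fix t
        have *: "(\<Sum>e\<in>E. indicator {t. u e t \<noteq> 0} t :: ennreal) \<le> 1"
        proof (cases "\<exists>e\<in>E. u e t \<noteq> 0")
          case True
          then obtain e where "e \<in> E" "u e t \<noteq> 0" by auto
          then have "(\<Sum>e\<in>E. indicator {t. u e t \<noteq> 0} t :: ennreal) =
              (\<Sum>e\<in>{e}. indicator {t. u e t \<noteq> 0} t)"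
            using \<open>finite E\<close> disj[of e] by (intro sum.mono_neutral_right) (auto simp: indicator_def)
          also have "\<dots> \<le> 1" by (simp split: split_indicator)
          finally show ?thesis .
        qed (simp add: indicator_def)
        show "(\<Sum>e\<in>E. ennreal (\<bar>g s t - ?q A t\<bar>) * indicator {t. u e t \<noteq> 0} t) \<le>
            ennreal \<bar>g s t - ?q A t\<bar>"
          using mult_left_mono[OF *, of "ennreal \<bar>g s t - ?q A t\<bar>"]
          unfolding sum_distrib_left by (simp only: mult_1_right zero_le)
      qed
      finally show "(\<Sum>e\<in>E. l A e s) \<le> (\<integral>\<^sup>+t. ennreal \<bar>g s t - ?q A t\<bar> \<partial>M)" .
    qed simp
    also have "\<dots> = R A"
    proof -
      have "(\<lambda>s. \<integral>\<^sup>+t. ennreal \<bar>g s t - ?q A t\<bar> \<partial>M) \<in> borel_measurable ?N"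
        using g2_meas[OF A] by measurable
      then have "(\<integral>\<^sup>+s. (\<integral>\<^sup>+t. ennreal \<bar>g s t - ?q A t\<bar> \<partial>M) \<partial>density ?N (\<lambda>s. ennreal (F A s)))
         = (\<integral>\<^sup>+s. ennreal (F A s) * (\<integral>\<^sup>+t. ennreal \<bar>g s t - ?q A t\<bar> \<partial>M) \<partial>?N)"
        using F_meas[OF A] by (subst nn_integral_density) auto
      moreover have "density ?N (\<lambda>s. ennreal (F A s)) = (\<Pi>\<^sub>M i\<in>{..<n}. density M (\<lambda>t. ennreal (?q A t)))"
        using PiM_density[OF \<open>prob_space M\<close>, of "{..<n}" "\<lambda>t. ennreal (?q A t)"] mass[OF A] q_meas[OF A] q0[OF A]
        by (simp add: F_def prod_ennreal)
      ultimately show ?thesis by (simp add: R_def)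
    qed
    finally show ?thesis .
  qed
  have pair: "\<delta> \<le> 8 * (L A e + L (insert e A) e)" if e: "e \<in> E" and A: "A \<subseteq> E - {e}" for A e
  proof -
    let ?B = "insert e A"
    have AE: "A \<subseteq> E" "?B \<subseteq> E" using A e by auto
    have qB: "?q ?B t = ?q A t + u e t" for t using A fin[OF AE(1)] by (intro perturbed_insert) auto
    have chi': "of_nat n * (\<integral>\<^sup>+t. ennreal ((?q A t - ?q ?B t)\<^sup>2) \<partial>M) \<le> 1"
      using chi[OF e] by (simp add: qB)
    have "1 \<le> 8 * (\<integral>\<^sup>+s. ennreal (min (F A s) (F ?B s)) \<partial>?N)"
      unfolding F_def
      by (rule nn_integral_min_product_density_ge)
         (use AE q_meas q_ge mass chi' \<open>1 \<le> n\<close> \<open>prob_space M\<close> in auto)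
    then have "\<delta> \<le> (8 * (\<integral>\<^sup>+s. ennreal (min (F A s) (F ?B s)) \<partial>?N)) * \<delta>"
      by (metis mult.left_neutral mult_right_mono zero_le)
    also have "\<dots> = 8 * (\<integral>\<^sup>+s. ennreal (min (F A s) (F ?B s)) * \<delta> \<partial>?N)"
      using F_meas[OF AE(1)] F_meas[OF AE(2)] by (subst nn_integral_multc) (auto simp: mult.assoc)
    also have "(\<integral>\<^sup>+s. ennreal (min (F A s) (F ?B s)) * \<delta> \<partial>?N) \<le> (\<integral>\<^sup>+s. ennreal (F A s) * l A e s +
        ennreal (F ?B s) * l ?B e s \<partial>?N)"
    proof (intro nn_integral_mono)
      fix s assume s: "s \<in> space ?N"
      have gs: "(\<lambda>t. ennreal \<bar>g s t - ?q B t\<bar>) \<in> borel_measurable M" if "B \<subseteq> E" for B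
        using measurable_compose[OF measurable_Pair1'[OF s] g2_meas[OF that]] by simp
      have m: "(\<lambda>t. ennreal (\<bar>g s t - ?q B t\<bar>) * indicator {t. u e t \<noteq> 0} t) \<in> borel_measurable M"
          if "B \<subseteq> E" for B
      proof -
        have [measurable]: "u e \<in> borel_measurable M" using u_meas e by auto
        have "(\<lambda>t. ennreal (\<bar>g s t - ?q B t\<bar>) *
            indicator {t\<in>space M. u e t \<noteq> 0} t) \<in> borel_measurable M"
          using gs[OF that] by measurable
        then show ?thesis
          by (rule measurable_cong[THEN iffD1, rotated]) (auto simp: indicator_def)
      qed
      have "\<delta> \<le> (\<integral>\<^sup>+t. ennreal \<bar>u e t\<bar> \<partial>M)" using sep e by auto
      also have "\<dots> \<le> (\<integral>\<^sup>+t. ennreal (\<bar>g s t - ?q A t\<bar>) * indicator {t. u e t \<noteq> 0} t +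
          ennreal (\<bar>g s t - ?q ?B t\<bar>) * indicator {t. u e t \<noteq> 0} t \<partial>M)"
        by (intro nn_integral_mono) (auto simp: qB indicator_def simp flip: ennreal_plus intro!: ennreal_leI)
      also have "\<dots> = l A e s + l ?B e s"
        unfolding l_def using m AE by (intro nn_integral_add) auto
      finally have "ennreal (min (F A s) (F ?B s)) * \<delta> \<le> ennreal (min (F A s) (F ?B s)) *
          (l A e s + l ?B e s)"
        by (intro mult_left_mono) auto
      also have "\<dots> \<le> ennreal (F A s) * l A e s + ennreal (F ?B s) * l ?B e s"
        unfolding distrib_left by (intro add_mono mult_right_mono ennreal_leI) auto
      finally show "ennreal (min (F A s) (F ?B s)) * \<delta> \<le> ennreal (F A s) * l A e s + ennreal (F ?B s) *
          l ?B e s" .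
    qed
    also have "\<dots> = L A e + L ?B e"
      unfolding L_def using AE F_meas l_meas e by (intro nn_integral_add) auto
    finally show ?thesis by (simp add: mult_left_mono)
  qed
  obtain A where A: "A \<subseteq> E" and A_max: "\<And>B. B \<subseteq> E \<Longrightarrow> R B \<le> R A"
  proof -
    have "finite (R ` Pow E)" "R ` Pow E \<noteq> {}" using \<open>finite E\<close> by auto
    then have "Max (R ` Pow E) \<in> R ` Pow E" by (rule Max_in)
    then obtain A where "A \<in> Pow E" "R A = Max (R ` Pow E)" by auto
    then show ?thesis using that[of A] \<open>finite E\<close> by auto
  qed
  have "of_nat (card E) * (2 ^ card E * \<delta>) = (\<Sum>e\<in>E. 2 ^ card E * \<delta>)"
    by simp
  also have "\<dots> \<le> (\<Sum>e\<in>E. 16 * (\<Sum>A\<in>Pow E. L A e))"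
  proof (rule sum_mono)
    fix e assume e: "e \<in> E"
    have c: "card E = Suc (card (E - {e}))"
      using e \<open>finite E\<close> by (metis card_Suc_Diff1)
    have "2 ^ card E * \<delta> = 2 * (\<Sum>A\<in>Pow (E - {e}). \<delta>)"
      unfolding c using \<open>finite E\<close> by (simp add: card_Pow mult.assoc)
    also have "\<dots> \<le> 2 * (\<Sum>A\<in>Pow (E - {e}). 8 * (L A e + L (insert e A) e))"
      using pair[OF e] by (intro mult_left_mono sum_mono) auto
    also have "\<dots> = 16 * (\<Sum>A\<in>Pow E. L A e)"
      by (simp only: sum_distrib_left[symmetric] sum_Pow_split[OF \<open>finite E\<close> e] mult.assoc[symmetric]) simp
    finally show "2 ^ card E * \<delta> \<le> 16 * (\<Sum>A\<in>Pow E. L A e)" .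
  qed
  also have "\<dots> = 16 * (\<Sum>A\<in>Pow E. \<Sum>e\<in>E. L A e)"
    by (simp only: sum_distrib_left[symmetric] sum.swap[of L E "Pow E"])
  also have "\<dots> \<le> 16 * (\<Sum>B\<in>Pow E. R A)"
    using R_ge A_max by (intro mult_left_mono sum_mono) (auto intro: order_trans)
  also have "\<dots> = 2 ^ card E * (16 * R A)"
    using \<open>finite E\<close> by (simp add: card_Pow mult_ac)
  finally have "2 ^ card E * (of_nat (card E) * \<delta>) \<le> 2 ^ card E * (16 * R A)"
    by (simp add: mult_ac)
  then have "of_nat (card E) * \<delta> \<le> 16 * R A"
    by (subst (asm) ennreal_mult_le_mult_iff) (auto simp: power_eq_top_ennreal)
  then show ?thesis using A unfolding R_def by blast
qed

section \<open>A smooth odd bump on the line\<close>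

definition trunc_poly :: "real poly \<Rightarrow> real \<Rightarrow> real" where
  "trunc_poly p t = (if 0 < t \<and> t < 1 then poly p t else 0)"

lemma trunc_poly_measurable: "trunc_poly p \<in> borel_measurable borel"
proof -
  have [measurable]: "poly p \<in> borel_measurable borel"
    by (intro borel_measurable_continuous_onI continuous_intros)
  show ?thesis unfolding trunc_poly_def by measurable
qed

text \<open>At the endpoints the difference quotient of the truncation is dominated by that of \<open>p\<close>, whose limit is
  \<open>0\<close>.\<close>

lemma trunc_poly_has_derivative:
  assumes p: "poly p 0 = 0" "poly p 1 = 0" and p': "poly (pderiv p) 0 = 0" "poly (pderiv p) 1 = 0"
  shows "(trunc_poly p has_real_derivative trunc_poly (pderiv p) t) (at t)"
proof -
  consider "0 < t \<and> t < 1" | "t < 0 \<or> 1 < t" | "t = 0 \<or> t = 1" by linarith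
  then show ?thesis
  proof cases
    case 1
    have "(poly p has_real_derivative poly (pderiv p) t) (at t)" by (rule poly_DERIV)
    then have "(trunc_poly p has_real_derivative poly (pderiv p) t) (at t)"
      by (rule has_field_derivative_transform_within_open[where S="{0<..<1}"])
         (use 1 in \<open>auto simp: trunc_poly_def\<close>)
    then show ?thesis using 1 by (simp add: trunc_poly_def)
  next
    case 2
    have "((\<lambda>_. 0) has_real_derivative 0) (at t)" by simp
    then have "(trunc_poly p has_real_derivative 0) (at t)"
      by (rule has_field_derivative_transform_within_open[where S="{..<0} \<union> {1<..}"])
         (use 2 in \<open>auto simp: trunc_poly_def\<close>)
    then show ?thesis using 2 by (auto simp add: trunc_poly_def)
  next
    case 3
    then have pt: "poly p t = 0" "poly (pderiv p) t = 0" "trunc_poly p t = 0" "trunc_poly (pderiv p) t =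
        0"
      using p p' by (auto simp: trunc_poly_def)
    have "((\<lambda>y. (poly p y - poly p t) / (y - t)) \<longlongrightarrow> 0) (at t)"
      using poly_DERIV[of p t] pt by (simp add: has_field_derivative_iff)
    then have "((\<lambda>y. (trunc_poly p y - trunc_poly p t) / (y - t)) \<longlongrightarrow> 0) (at t)"
      by (rule Lim_null_comparison[rotated, OF tendsto_norm_zero])
         (auto simp: pt trunc_poly_def intro!: always_eventually)
    then show ?thesis by (simp add: has_field_derivative_iff pt)
  qed
qed

lemma power_dvd_pderiv:
  fixes w :: "real poly"
  assumes "w ^ Suc k dvd p" shows "w ^ k dvd pderiv p"
proof -
  obtain r where "p = w ^ Suc k * r" using assms by (rule dvdE)
  then have "pderiv p = w ^ Suc k * pderiv r + r * (smult (of_nat (Suc k)) (w ^ k) * pderiv w)"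
    by (simp only: pderiv_mult pderiv_power_Suc)
  also have "\<dots> = w ^ k * (w * pderiv r + r * smult (of_nat (Suc k)) (pderiv w))"
    by (simp add: algebra_simps)
  finally have "pderiv p = w ^ k * (w * pderiv r + r * smult (of_nat (Suc k)) (pderiv w))" .
  then show ?thesis by simp
qed

lemma power_dvd_higher_pderiv:
  fixes w :: "real poly"
  assumes "w ^ (j + k) dvd p" shows "w ^ j dvd (pderiv ^^ k) p"
  using assms by (induction k arbitrary: j) (auto intro: power_dvd_pderiv simp flip: power_Suc)

text \<open>The \<open>b k\<close> are the derivatives of the bump \<open>b 0\<close> up to order \<open>m + 1\<close>.  They are normalised to be bounded
  by \<open>1\<close>, so that products over coordinates are bounded by \<open>1\<close> too, with Lipschitz constants that simply
  add up.  Oddness about \<open>1/2\<close> gives mean zero, and the values on \<open>(0, 1/2)\<close> give positive \<open>L\<^sup>1\<close> norm.\<close>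

locale bump_tower =
  fixes b :: "nat \<Rightarrow> real \<Rightarrow> real" and m :: nat
  assumes b_deriv: "\<And>k t. k \<le> m \<Longrightarrow> (b k has_real_derivative b (Suc k) t) (at t)"
    and b_bound: "\<And>k t. k \<le> Suc m \<Longrightarrow> \<bar>b k t\<bar> \<le> 1"
    and b_zero: "\<And>k t. \<not> (0 < t \<and> t < 1) \<Longrightarrow> b k t = 0"
    and b_meas[measurable]: "\<And>k. b k \<in> borel_measurable borel"
    and b_odd: "\<And>t. b 0 (1 - t) = - b 0 t"
    and b_nonzero: "\<And>t. 0 < t \<Longrightarrow> t < 1/2 \<Longrightarrow> b 0 t \<noteq> 0"

text \<open>A multiple of \<open>(t (1 - t))\<^bsup>m+2\<^esup> (1 - 2 t)\<close>, truncated to the unit interval: the zeros of order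
  \<open>m + 2\<close> at the endpoints survive \<open>m + 1\<close> differentiations, and the last factor is odd about \<open>1/2\<close>.\<close>

lemma bump_tower_exists: "\<exists>b. bump_tower b m"
proof -
  define w :: "real poly" where "w = [:0, 1, -1:]"
  define p where "p = w ^ (m + 2) * [:1, -2:]"
  define q where "q k = (pderiv ^^ k) p" for k
  have "\<exists>B. \<forall>t\<in>{0..1}. \<bar>poly (q k) t\<bar> \<le> B" for k
  proof -
    have "compact ((poly (q k)) ` {0..1})"
      by (intro compact_continuous_image continuous_intros) auto
    then have "bounded ((poly (q k)) ` {0..1})" by (rule compact_imp_bounded)
    then show ?thesis unfolding bounded_iff by auto
  qed
  then obtain B where B: "\<And>k t. t \<in> {0..1} \<Longrightarrow> \<bar>poly (q k) t\<bar> \<le> B k" by metis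
  \<comment> \<open>\<open>S\<close> bounds all derivatives of order at most \<open>m + 1\<close> and is the normalising constant.\<close>
  define S where "S = 1 + (\<Sum>k\<le>Suc m. \<bar>B k\<bar>)"
  have "0 \<le> (\<Sum>k\<le>Suc m. \<bar>B k\<bar>)" by (intro sum_nonneg) auto
  then have S: "S > 0" unfolding S_def by linarith
  have BS: "B k \<le> S" if "k \<le> Suc m" for k
  proof -
    have "\<bar>B k\<bar> \<le> (\<Sum>k\<le>Suc m. \<bar>B k\<bar>)" by (rule member_le_sum) (use that in auto)
    then show ?thesis by (simp add: S_def)
  qed
  have q_zero: "poly (q k) t = 0" if "k \<le> Suc m" "t = 0 \<or> t = 1" for k t
  proof -
    have "w ^ (1 + k) dvd w ^ (m + 2)" using that by (intro le_imp_power_dvd) auto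
    then have "w ^ (1 + k) dvd p" unfolding p_def by (rule dvd_mult2)
    then have "w ^ 1 dvd q k" unfolding q_def by (rule power_dvd_higher_pderiv)
    then obtain r where "q k = w * r" by (auto elim: dvdE)
    then show ?thesis using that by (auto simp: w_def)
  qed
  have q_Suc: "q (Suc k) = pderiv (q k)" for k by (simp add: q_def)
  define b where "b k t = trunc_poly (q k) t / S" for k t
  have "bump_tower b m"
  proof
    show "(b k has_real_derivative b (Suc k) t) (at t)" if "k \<le> m" for k t
      unfolding b_def[abs_def] q_Suc using that q_zero[of k] q_zero[of "Suc k"] S
      by (intro DERIV_cdivide trunc_poly_has_derivative) (auto simp: q_Suc)
    show "\<bar>b k t\<bar> \<le> 1" if "k \<le> Suc m" for k t
      using B[of t k] BS[OF that] S by (auto simp: b_def trunc_poly_def)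
    show "b k t = 0" if "\<not> (0 < t \<and> t < 1)" for k t
      using that by (auto simp: b_def trunc_poly_def)
    show "b k \<in> borel_measurable borel" for k
      unfolding b_def[abs_def] using trunc_poly_measurable by measurable
    show "b 0 (1 - t) = - b 0 t" for t
    proof -
      have "poly w (1 - t) = poly w t" by (simp add: w_def algebra_simps)
      then have "poly (q 0) (1 - t) = - poly (q 0) t" by (simp add: q_def p_def algebra_simps)
      then show ?thesis by (auto simp: b_def trunc_poly_def)
    qed
    show "b 0 t \<noteq> 0" if "0 < t" "t < 1/2" for t
    proof -
      have "poly w t = t * (1 - t)" by (simp add: w_def algebra_simps)
      then have "poly (q 0) t = (t * (1 - t)) ^ (m + 2) * (1 - 2 * t)"
        unfolding q_def p_def by (simp only: funpow_0 poly_mult poly_power) simp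
      also have "\<dots> \<noteq> 0" using that by simp
      finally show ?thesis using that S by (simp add: b_def trunc_poly_def)
    qed
  qed
  then show ?thesis by blast
qed

context bump_tower
begin

definition bump_mass :: real where "bump_mass = integral\<^sup>L lborel (\<lambda>t. \<bar>b 0 t\<bar>)"

lemma b_integrable: "integrable lborel (b 0)"
proof -
  have *: "b 0 t = indicator {0..1} t *\<^sub>R b 0 t" for t
    by (cases "0 < t \<and> t < 1") (auto simp: indicator_def b_zero)
  have "integrable lborel (\<lambda>t. indicator {0..1} t *\<^sub>R b 0 t)"
    by (intro integrableI_bounded_set_indicator[where B=1]) (auto simp: b_bound)
  then show ?thesis by (simp only: *[symmetric])
qed

lemma b_integral_zero: "integral\<^sup>L lborel (b 0) = 0"
proof -
  have "integral\<^sup>L lborel (b 0) = integral\<^sup>L lborel (\<lambda>t. b 0 (1 + (-1) * t))"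
    using lborel_integral_real_affine[of "-1" "b 0" 1] by simp
  also have "\<dots> = - integral\<^sup>L lborel (b 0)" by (simp add: b_odd)
  finally show ?thesis by simp
qed

lemma nn_integral_abs_b: "(\<integral>\<^sup>+t. ennreal \<bar>b 0 t\<bar> \<partial>lborel) = ennreal bump_mass"
  unfolding bump_mass_def using b_integrable by (intro nn_integral_eq_integral) auto

lemma bump_mass_pos: "0 < bump_mass"
proof -
  have "bump_mass \<noteq> 0"
  proof
    assume "bump_mass = 0"
    then have "AE t in lborel. ennreal \<bar>b 0 t\<bar> = 0"
      using nn_integral_abs_b by (subst nn_integral_0_iff_AE[symmetric]) auto
    then have "AE t in lborel. t \<notin> {0<..<1/2::real}"
      by eventually_elim (use b_nonzero in force)
    moreover have "{x \<in> space lborel. \<not> x \<notin> {0<..<1/2}} = {0<..<1/2::real}" by auto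
    ultimately have "emeasure lborel {0<..<1/2::real} = 0"
      by (subst (asm) AE_iff_measurable[where N="{0<..<1/2}"]) auto
    then show False by (simp only: emeasure_lborel_Ioo) simp
  qed
  moreover have "0 \<le> bump_mass" by (simp add: bump_mass_def)
  ultimately show ?thesis by simp
qed

end

section \<open>Moduli of continuity and iterated partial derivatives\<close>

text \<open>Think of \<open>g e\<close> and \<open>h e\<close> as the values at two points of functions with disjoint supports.  Each point lies
  in at most one support, so at most two indices contribute to the difference of the sums.\<close>

lemma abs_sum_disjoint_diff_le:
  fixes g h :: "'e \<Rightarrow> real"
  assumes g: "\<And>e e'. e \<in> A \<Longrightarrow> e' \<in> A \<Longrightarrow> e \<noteq> e' \<Longrightarrow> g e = 0 \<or> g e' = 0"
    and h: "\<And>e e'. e \<in> A \<Longrightarrow> e' \<in> A \<Longrightarrow> e \<noteq> e' \<Longrightarrow> h e = 0 \<or> h e' = 0"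
    and B: "\<And>e. e \<in> A \<Longrightarrow> \<bar>g e - h e\<bar> \<le> B" "0 \<le> B"
  shows "\<bar>(\<Sum>e\<in>A. g e) - (\<Sum>e\<in>A. h e)\<bar> \<le> 2 * B"
proof -
  have "(\<Sum>e\<in>A. g e) - (\<Sum>e\<in>A. h e) = (\<Sum>e\<in>A. if g e \<noteq> 0 then g e - h e else 0) +
      (\<Sum>e\<in>A. if g e = 0 then g e - h e else 0)"
    by (auto simp: sum_subtractf[symmetric] sum.distrib[symmetric] intro!: sum.cong)
  moreover have "\<bar>\<Sum>e\<in>A. if g e \<noteq> 0 then g e - h e else 0\<bar> \<le> B"
  proof (rule abs_sum_disjoint_le)
    fix e e' assume "e \<in> A" "e' \<in> A" "e \<noteq> e'"
    then show "(if g e \<noteq> 0 then g e - h e else 0) = 0 \<or> (if g e' \<noteq> 0 then g e' - h e' else 0) = 0"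
      using g[of e e'] by auto
  next
    show "\<bar>if g e \<noteq> 0 then g e - h e else 0\<bar> \<le> B" if "e \<in> A" for e
      using B(1)[OF that] B(2) by (cases "g e = 0") simp_all
  qed fact
  moreover have "\<bar>\<Sum>e\<in>A. if g e = 0 then g e - h e else 0\<bar> \<le> B"
  proof (rule abs_sum_disjoint_le)
    fix e e' assume "e \<in> A" "e' \<in> A" "e \<noteq> e'"
    then show "(if g e = 0 then g e - h e else 0) = 0 \<or> (if g e' = 0 then g e' - h e' else 0) = 0"
      using h[of e e'] by auto
  next
    show "\<bar>if g e = 0 then g e - h e else 0\<bar> \<le> B" if "e \<in> A" for e
      using B(1)[OF that] B(2) by (cases "g e = 0") simp_all
  qed fact
  ultimately show ?thesis by linarith
qed

lemma l1_norm_nonneg: "0 \<le> l1_norm v"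
  by (simp add: l1_norm_def sum_nonneg)

text \<open>This interpolates between a bound on the size and a Lipschitz bound to a Hoelder bound.\<close>

lemma min_two_le_powr:
  fixes t \<theta> d :: real
  assumes "0 \<le> t" "0 < \<theta>" "\<theta> \<le> 1" "d \<le> 2" "d \<le> t"
  shows "d \<le> 2 * t powr \<theta>"
proof (cases "t \<le> 1")
  case True
  have "t \<le> t powr \<theta>"
  proof (cases "t = 0")
    case False
    then have "t powr 1 \<le> t powr \<theta>" using assms True by (intro powr_mono') auto
    then show ?thesis using assms False by simp
  qed simp
  moreover have "0 \<le> t powr \<theta>" by simp
  ultimately show ?thesis using assms by linarith
next
  case False
  then have "1 \<le> t powr \<theta>" using assms by (intro ge_one_powr_ge_zero) auto
  then show ?thesis using assms by linarith
qed

text \<open>Off \<open>S\<close>, the derivative within \<open>S\<close> may be an arbitrary choice, so that iterated derivatives can be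
  identified with given functions on \<open>S\<close> only.  Each further derivative within \<open>S\<close> is determined by
  these values, so agreement on \<open>S\<close> is inherited by all orders.\<close>

lemma times_differentiable_on_cong:
  assumes "\<And>x. x \<in> S \<Longrightarrow> f x = g x"
  shows "times_differentiable_on k S f = times_differentiable_on k S g"
    and "x \<in> S \<Longrightarrow> partial_deriv S i f x = partial_deriv S i g x"
proof -
  have *: "frechet_derivative f (at x within S) = frechet_derivative g (at x within S)"
    if "x \<in> S" "\<And>x. x \<in> S \<Longrightarrow> f x = g x" for x and f g :: "real ^ 'a \<Rightarrow> real"
    unfolding frechet_derivative_def using that by (metis (no_types, lifting) has_derivative_transform)
  show "partial_deriv S i f x = partial_deriv S i g x" if "x \<in> S"
  proof -
    have "frechet_derivative f (at x within S) = frechet_derivative g (at x within S)"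
      by (rule *[OF that]) (rule assms)
    then show ?thesis by (simp add: partial_deriv_def)
  qed
  show "times_differentiable_on k S f = times_differentiable_on k S g"
    using assms
  proof (induction k arbitrary: f g)
    case (Suc k)
    have diff: "g differentiable_on S" if "f differentiable_on S" "\<And>x. x \<in> S \<Longrightarrow> f x = g x"
      for f g :: "real ^ 'a \<Rightarrow> real"
      unfolding differentiable_on_def
    proof
      fix x assume x: "x \<in> S"
      then obtain D where "(f has_derivative D) (at x within S)"
        using \<open>f differentiable_on S\<close> by (auto simp: differentiable_on_def differentiable_def)
      then have "(g has_derivative D) (at x within S)"
        using x that(2) by (intro has_derivative_transform[of x S g f D]) auto
      then show "g differentiable (at x within S)" by (auto simp: differentiable_def)
    qed
    have "f differentiable_on S \<longleftrightarrow> g differentiable_on S"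
      by (intro iffI) (erule diff, simp add: Suc.prems)+
    moreover have "times_differentiable_on k S (partial_deriv S i f) =
        times_differentiable_on k S (partial_deriv S i g)" for i
      by (rule Suc.IH) (simp add: partial_deriv_def *[of _ f g, OF _ Suc.prems])
    ultimately show ?case by simp
  qed simp
qed

lemma partial_deriv_unit_cube:
  fixes f :: "real ^ 'n \<Rightarrow> real"
  assumes "(f has_derivative (\<lambda>v. \<Sum>i\<in>UNIV. v $ i * D i)) (at x within unit_cube)" "x \<in> unit_cube"
  shows "partial_deriv unit_cube j f x = D j"
proof -
  have "frechet_derivative f (at x within unit_cube) = (\<lambda>v. \<Sum>i\<in>UNIV. v $ i * D i)"
    using assms by (intro frechet_derivative_within_cbox) (auto simp: Basis_vec_def inner_axis)
  then show ?thesis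
    by (simp add: partial_deriv_def axis_def if_distrib[of "\<lambda>a. a * _"] cong: if_cong)
qed

text \<open>Candidates for all iterated derivatives are indexed by the list of directions, the last applied first, as
  in \<open>foldr\<close>.  If each candidate differentiates to the next ones, they are the iterated derivatives.\<close>

lemma derivative_family:
  fixes f :: "'n::finite list \<Rightarrow> real ^ 'n \<Rightarrow> real"
  assumes "\<And>js x. length js < k \<Longrightarrow> x \<in> unit_cube \<Longrightarrow>
    (f js has_derivative (\<lambda>v. \<Sum>i\<in>UNIV. v $ i * f (i # js) x)) (at x within unit_cube)"
  shows "times_differentiable_on k unit_cube (f [])"
    and "length js \<le> k \<Longrightarrow> x \<in> unit_cube \<Longrightarrow> foldr (partial_deriv unit_cube) js (f []) x = f js x"
proof -
  show "times_differentiable_on k unit_cube (f [])"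
    using assms
  proof (induction k arbitrary: f)
    case (Suc k)
    have "times_differentiable_on k unit_cube (f [i])" for i
    proof -
      have "times_differentiable_on k unit_cube ((\<lambda>js. f (js @ [i])) [])"
        by (rule Suc.IH) (use Suc.prems[of "_ @ [i]"] in simp)
      then show ?thesis by simp
    qed
    moreover have "partial_deriv unit_cube i (f []) x = f [i] x" if "x \<in> unit_cube" for i x
      using Suc.prems[of "[]" x] that by (intro partial_deriv_unit_cube) auto
    ultimately have "times_differentiable_on k unit_cube (partial_deriv unit_cube i (f []))" for i
      using times_differentiable_on_cong(1) by blast
    moreover have "f [] differentiable_on unit_cube"
      unfolding differentiable_on_def differentiable_def using Suc.prems[of "[]"] by auto
    ultimately show ?case by simp
  qed simp
  show "foldr (partial_deriv unit_cube) js (f []) x = f js x" if "length js \<le> k" "x \<in> unit_cube"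
    using that
  proof (induction js arbitrary: x)
    case (Cons j js)
    have "partial_deriv unit_cube j (foldr (partial_deriv unit_cube) js (f [])) x =
        partial_deriv unit_cube j (f js) x"
      by (rule times_differentiable_on_cong(2)) (use Cons in auto)
    also have "\<dots> = f (j # js) x"
      using assms[of js x] Cons.prems by (intro partial_deriv_unit_cube) auto
    finally show ?case by simp
  qed simp
qed

text \<open>Some list of directions realises every multi-index, so the choice in \<open>multi_deriv\<close> is a genuine
  iterated partial derivative of the right order.\<close>

lemma multi_deriv_obtain:
  fixes \<alpha> :: "'n::finite \<Rightarrow> nat"
  obtains js where "length js = (\<Sum>i\<in>UNIV. \<alpha> i)" "\<And>S f. multi_deriv S \<alpha> f = foldr (partial_deriv S) js f"
proof -
  let ?js = "SOME js. \<forall>i. count_list js i = \<alpha> i"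
  have "finite {x. 0 < \<alpha> x}" by (rule finite)
  then have M: "count (Abs_multiset \<alpha>) = \<alpha>" by (rule count_Abs_multiset)
  obtain ks where "mset ks = Abs_multiset \<alpha>" using ex_mset[of "Abs_multiset \<alpha>"] by blast
  then have "\<forall>i. count_list ks i = \<alpha> i" using M count_mset[of ks] by simp
  then have js: "\<forall>i. count_list ?js i = \<alpha> i" by (rule someI)
  have "(\<Sum>i\<in>UNIV. count_list ?js i) = length ?js" by (rule sum_count_set) auto
  then show ?thesis using js by (intro that[of ?js]) (auto simp: multi_deriv_def)
qed

section \<open>Product bumps on a grid\<close>

context bump_tower
begin

lemma b_lipschitz:
  assumes "k \<le> m" shows "\<bar>b k s - b k t\<bar> \<le> \<bar>s - t\<bar>"
proof -
  have "norm (b k s - b k t) \<le> 1 * norm (s - t)"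
    using assms b_deriv b_bound
    by (intro field_differentiable_bound[where S=UNIV and f'="b (Suc k)"])
       (auto intro: has_field_derivative_at_within)
  then show ?thesis by simp
qed

text \<open>In the cell \<open>i\<close> of the grid with mesh \<open>1/N\<close>, this is the derivative of multi-index \<open>\<alpha>\<close> of the product
  bump \<open>cube_bump N i (\<lambda>_. 0)\<close>, divided by the factor \<open>N\<close> to the power \<open>\<bar>\<alpha>\<bar>\<close> from the chain rule.\<close>

definition cube_bump :: "nat \<Rightarrow> ('n::finite \<Rightarrow> nat) \<Rightarrow> ('n \<Rightarrow> nat) \<Rightarrow> real ^ 'n \<Rightarrow> real" where
  "cube_bump N i \<alpha> x = (\<Prod>k\<in>UNIV. b (\<alpha> k) (real N * x $ k - real (i k)))"

lemma cube_bump_nonzeroD: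
  assumes "cube_bump N i \<alpha> x \<noteq> 0"
  shows "real (i k) < real N * x $ k" "real N * x $ k < real (i k) + 1"
proof -
  have "b (\<alpha> k) (real N * x $ k - real (i k)) \<noteq> 0"
    using assms by (auto simp: cube_bump_def)
  then show "real (i k) < real N * x $ k" "real N * x $ k < real (i k) + 1"
    using b_zero[of "real N * x $ k - real (i k)" "\<alpha> k"] by linarith+
qed

lemma cube_bump_disjoint:
  assumes "i \<noteq> i'" shows "cube_bump N i \<alpha> x = 0 \<or> cube_bump N i' \<alpha>' x = 0"
proof (rule ccontr)
  assume *: "\<not> ?thesis"
  obtain k where k: "i k \<noteq> i' k" using assms by auto
  have "real (i k) < real (i' k) + 1" "real (i' k) < real (i k) + 1"
    using * cube_bump_nonzeroD[of N i \<alpha> x k] cube_bump_nonzeroD[of N i' \<alpha>' x k] by fastforce+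
  then show False using k by linarith
qed

lemma cube_bump_bound: "(\<And>k. \<alpha> k \<le> Suc m) \<Longrightarrow> \<bar>cube_bump N i \<alpha> x\<bar> \<le> 1"
  unfolding cube_bump_def abs_prod using b_bound by (intro prod_le_1) auto

lemma cube_bump_lipschitz:
  assumes "\<And>k. \<alpha> k \<le> m"
  shows "\<bar>cube_bump N i \<alpha> x - cube_bump N i \<alpha> y\<bar> \<le> real N * l1_norm (x - y)"
proof -
  have "norm (cube_bump N i \<alpha> x - cube_bump N i \<alpha> y) \<le>
      (\<Sum>k\<in>UNIV. norm (b (\<alpha> k) (real N * x $ k - real (i k)) - b (\<alpha> k) (real N * y $ k - real (i k))))"
    unfolding cube_bump_def using assms le_Suc_eq b_bound by (intro norm_prod_diff) auto
  also have "\<dots> \<le> (\<Sum>k\<in>UNIV. real N * \<bar>x $ k - y $ k\<bar>)"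
  proof (rule sum_mono)
    fix k
    have "\<bar>real N * x $ k - real N * y $ k\<bar> = real N * \<bar>x $ k - y $ k\<bar>"
      by (simp add: abs_mult flip: right_diff_distrib)
    then show "norm (b (\<alpha> k) (real N * x $ k - real (i k)) - b (\<alpha> k) (real N * y $ k - real (i k))) \<le>
        real N * \<bar>x $ k - y $ k\<bar>"
      using b_lipschitz[OF assms[of k], of "real N * x $ k - real (i k)" "real N * y $ k - real (i k)"]
          by simp
  qed
  finally show ?thesis by (simp add: l1_norm_def sum_distrib_left)
qed

lemma cube_bump_holder:
  assumes "\<And>k. \<alpha> k \<le> m" "0 < \<theta>" "\<theta> \<le> 1"
  shows "\<bar>cube_bump N i \<alpha> x - cube_bump N i \<alpha> y\<bar> \<le> 2 * (real N * l1_norm (x - y)) powr \<theta>"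
proof (rule min_two_le_powr)
  have "\<bar>cube_bump N i \<alpha> x\<bar> \<le> 1" "\<bar>cube_bump N i \<alpha> y\<bar> \<le> 1"
    using assms(1) by (auto intro!: cube_bump_bound le_SucI)
  then show "\<bar>cube_bump N i \<alpha> x - cube_bump N i \<alpha> y\<bar> \<le> 2" by linarith
  show "0 \<le> real N * l1_norm (x - y)" using l1_norm_nonneg[of "x - y"] by simp
  show "\<bar>cube_bump N i \<alpha> x - cube_bump N i \<alpha> y\<bar> \<le> real N * l1_norm (x - y)"
    by (rule cube_bump_lipschitz) fact
qed (use assms in auto)

lemma cube_bump_has_derivative:
  assumes "\<And>k. \<alpha> k \<le> m"
  shows "(cube_bump N i \<alpha> has_derivative
    (\<lambda>v. \<Sum>k\<in>UNIV. v $ k * (real N * cube_bump N i (\<alpha>(k := Suc (\<alpha> k))) x))) (at x within S)"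
proof -
  have 1: "((\<lambda>x. b (\<alpha> k) (real N * x $ k - real (i k))) has_derivative
      (\<lambda>v. real N * v $ k * b (Suc (\<alpha> k)) (real N * x $ k - real (i k)))) (at x within S)" for k
  proof -
    have "((\<lambda>x. real N * x $ k - real (i k)) has_derivative (\<lambda>v. real N * v $ k)) (at x within S)"
      by (auto intro!: derivative_eq_intros bounded_linear_imp_has_derivative[OF bounded_linear_vec_nth])
    then show ?thesis
      by (intro DERIV_compose_FDERIV[where f="b (\<alpha> k)"] b_deriv assms)
  qed
  have "(cube_bump N i \<alpha> has_derivative
      (\<lambda>v. \<Sum>k\<in>UNIV. (real N * v $ k * b (Suc (\<alpha> k)) (real N * x $ k - real (i k))) * 
         (\<Prod>j\<in>UNIV - {k}. b (\<alpha> j) (real N * x $ j - real (i j))))) (at x within S)"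
    unfolding cube_bump_def[abs_def] by (intro has_derivative_prod 1)
  moreover have "cube_bump N i (\<alpha>(k := Suc (\<alpha> k))) x = b (Suc (\<alpha> k)) (real N * x $ k - real (i k)) *
      (\<Prod>j\<in>UNIV - {k}. b (\<alpha> j) (real N * x $ j - real (i j)))" for k
    unfolding cube_bump_def by (subst prod.remove[of _ k]) auto
  ultimately show ?thesis by (simp add: mult_ac)
qed

lemma cube_bump_measurable [measurable]: "cube_bump N i \<alpha> \<in> borel_measurable borel"
proof -
  have "(\<lambda>x. b (\<alpha> k) (real N * x $ k - real (i k))) \<in> borel_measurable borel" for k
    by (rule measurable_compose[OF _ b_meas]) (intro borel_measurable_continuous_onI continuous_intros)
  then show ?thesis unfolding cube_bump_def[abs_def] by measurable
qed

end

section \<open>Integrals of products over the coordinates\<close>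

lemma Basis_vec_eq_axis: "(Basis :: (real ^ 'n) set) = (\<lambda>k. axis k 1) ` UNIV"
  by (auto simp: Basis_vec_def)

lemma inj_axis_one: "inj (\<lambda>k :: 'n::finite. axis k (1::real))"
  by (auto simp: inj_on_def axis_eq_axis)

lemma prod_Basis_axis: "(\<Prod>b\<in>(Basis :: (real ^ 'n) set). F b) = (\<Prod>k\<in>UNIV. F (axis k 1))"
  unfolding Basis_vec_eq_axis by (subst prod.reindex[OF inj_axis_one]) simp

lemma emeasure_unit_cube: "emeasure lborel (unit_cube :: (real ^ 'n) set) = 1"
proof -
  have "(\<Prod>b\<in>(Basis :: (real ^ 'n) set). (1 - 0) \<bullet> b) = 1"
    by (simp add: prod_Basis_axis inner_axis)
  moreover have "0 \<bullet> b \<le> 1 \<bullet> b" if "b \<in> Basis" for b :: "real ^ 'n"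
    using that by (auto simp: Basis_vec_eq_axis inner_axis)
  ultimately show ?thesis by (subst emeasure_lborel_cbox) auto
qed

lemma nn_integral_vec_prod:
  fixes f :: "'n::finite \<Rightarrow> real \<Rightarrow> ennreal"
  assumes [measurable]: "\<And>k. f k \<in> borel_measurable borel"
  shows "(\<integral>\<^sup>+x. (\<Prod>k\<in>UNIV. f k (x $ k)) \<partial>lborel) = (\<Prod>k\<in>UNIV. \<integral>\<^sup>+t. f k t \<partial>lborel)"
proof -
  define F where "F b = f (inv (\<lambda>k. axis k (1::real)) b)" for b :: "real ^ 'n"
  have F: "F (axis k 1) = f k" for k
    unfolding F_def using inv_f_f[OF inj_axis_one, of k] by simp
  have "(\<integral>\<^sup>+x. (\<Prod>b\<in>Basis. F b (x \<bullet> b)) \<partial>lborel) = (\<Prod>b\<in>Basis. \<integral>\<^sup>+t. F b t \<partial>lborel)"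
    by (rule nn_integral_lborel_prod) (auto simp: F_def)
  then show ?thesis
    by (simp add: prod_Basis_axis F inner_axis)
qed

text \<open>Lebesgue measure is the image of a product measure indexed by \<open>Basis\<close>, which \<open>k \<mapsto> axis k 1\<close>
  identifies with the set of coordinates.\<close>

lemma lborel_integral_vec_prod:
  fixes f :: "'n::finite \<Rightarrow> real \<Rightarrow> real"
  assumes int: "\<And>k. integrable lborel (f k)"
  shows "(\<integral>x. (\<Prod>k\<in>UNIV. f k (x $ k)) \<partial>lborel) = (\<Prod>k\<in>UNIV. \<integral>t. f k t \<partial>lborel)"
proof -
  interpret P: product_sigma_finite "\<lambda>_ :: real ^ 'n. lborel :: real measure" by standard
  define F where "F b = f (inv (\<lambda>k. axis k (1::real)) b)" for b :: "real ^ 'n"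
  have F: "F (axis k 1) = f k" for k
    unfolding F_def using inv_f_f[OF inj_axis_one, of k] by simp
  have [measurable]: "f k \<in> borel_measurable borel" for k
    using borel_measurable_integrable[OF int[of k]] by simp
  have [measurable]: "F b \<in> borel_measurable borel" for b by (simp add: F_def)
  have "(\<integral>x. (\<Prod>b\<in>Basis. F b (x \<bullet> b)) \<partial>lborel) =
      (\<integral>g. (\<Prod>b\<in>Basis. F b ((\<Sum>c\<in>Basis. g c *\<^sub>R c) \<bullet> b)) \<partial>(\<Pi>\<^sub>M b\<in>(Basis :: (real ^ 'n) set). lborel))"
    by (subst lborel_eq, rule integral_distr) measurable
  also have "\<dots> = (\<integral>g. (\<Prod>b\<in>Basis. F b (g b)) \<partial>(\<Pi>\<^sub>M b\<in>(Basis :: (real ^ 'n) set). lborel))"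
    by (intro Bochner_Integration.integral_cong refl prod.cong) simp
  also have "\<dots> = (\<Prod>b\<in>Basis. \<integral>t. F b t \<partial>lborel)"
    by (rule P.product_integral_prod) (auto simp: F_def int)
  finally show ?thesis
    by (simp add: prod_Basis_axis F inner_axis)
qed

section \<open>The perturbed conditional densities\<close>

lemma strict_floor_bounds:
  assumes "0 < \<beta>"
  shows "real (strict_floor \<beta>) < \<beta>" "\<beta> \<le> real (strict_floor \<beta>) + 1"
proof -
  let ?P = "\<lambda>k. real k < \<beta>"
  have bd: "\<And>k. ?P k \<Longrightarrow> k \<le> nat \<lceil>\<beta>\<rceil>" by linarith
  show "real (strict_floor \<beta>) < \<beta>"
    unfolding strict_floor_def by (rule GreatestI_nat[of ?P 0 "nat \<lceil>\<beta>\<rceil>"]) (use assms bd in auto)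
  have "\<not> real (Suc (strict_floor \<beta>)) < \<beta>"
  proof
    assume "real (Suc (strict_floor \<beta>)) < \<beta>"
    then have "Suc (strict_floor \<beta>) \<le> strict_floor \<beta>"
      unfolding strict_floor_def by (rule Greatest_le_nat) (use bd in auto)
    then show False by simp
  qed
  then show "\<beta> \<le> real (strict_floor \<beta>) + 1" by simp
qed

context bump_tower
begin

lemma bump_mass_le_1: "bump_mass \<le> 1"
proof -
  have "ennreal bump_mass \<le> (\<integral>\<^sup>+t. indicator {0..1::real} t \<partial>lborel)"
    unfolding nn_integral_abs_b[symmetric]
  proof (intro nn_integral_mono)
    fix t show "ennreal \<bar>b 0 t\<bar> \<le> indicator {0..1} t"
      using b_bound[of 0 t] by (cases "0 < t \<and> t < 1") (auto simp: b_zero indicator_def)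
  qed
  then show ?thesis by simp
qed

lemma cube_bump_support:
  assumes "cube_bump N i \<alpha> x \<noteq> 0" "\<And>k. i k < N"
  shows "x \<in> unit_cube"
proof -
  have "0 \<le> x $ k \<and> x $ k \<le> 1" for k
  proof -
    have *: "0 \<le> real (i k)" "real (i k) + 1 \<le> real N" "0 < real N" using assms(2)[of k] by auto
    have "real N * 0 < real N * x $ k" "real N * x $ k < real N * 1"
      using cube_bump_nonzeroD[OF assms(1), of k] * by linarith+
    then have "0 < x $ k" "x $ k < 1" using mult_less_cancel_left_pos[OF *(3)] by blast+
    then show ?thesis by simp
  qed
  then show ?thesis by (simp add: mem_box_cart)
qed

lemma nn_integral_abs_cube_bump:
  assumes "1 \<le> N"
  shows "(\<integral>\<^sup>+x. ennreal \<bar>cube_bump N i (\<lambda>_. 0) (x :: real ^ 'n)\<bar> \<partial>lborel) =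
    ennreal ((bump_mass / real N) ^ CARD('n::finite))"
proof -
  have 1: "(\<integral>\<^sup>+t. ennreal \<bar>b 0 (real N * t - real j)\<bar> \<partial>lborel) = ennreal (bump_mass / real N)" for j
  proof -
    have "(\<integral>\<^sup>+t. ennreal \<bar>b 0 t\<bar> \<partial>lborel) = ennreal \<bar>real N\<bar> *
        (\<integral>\<^sup>+t. ennreal \<bar>b 0 (- real j + real N * t)\<bar> \<partial>lborel)"
      using assms by (intro nn_integral_real_affine) auto
    then have *: "ennreal bump_mass = ennreal (real N) *
        (\<integral>\<^sup>+t. ennreal \<bar>b 0 (real N * t - real j)\<bar> \<partial>lborel)"
      by (simp add: nn_integral_abs_b)
    have "ennreal (1 / real N) * ennreal bump_mass = (ennreal (1 / real N) * ennreal (real N)) *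
        (\<integral>\<^sup>+t. ennreal \<bar>b 0 (real N * t - real j)\<bar> \<partial>lborel)"
      by (simp only: * mult.assoc)
    also have "ennreal (1 / real N) * ennreal (real N) = 1"
      using assms by (subst ennreal_mult[symmetric]) auto
    also have "ennreal (1 / real N) * ennreal bump_mass = ennreal (bump_mass / real N)"
      using assms bump_mass_pos by (subst ennreal_mult[symmetric]) auto
    finally show ?thesis by simp
  qed
  have "(\<integral>\<^sup>+x. ennreal \<bar>cube_bump N i (\<lambda>_. 0) x\<bar> \<partial>lborel) =
      (\<integral>\<^sup>+(x :: real ^ 'n). (\<Prod>k\<in>UNIV. ennreal \<bar>b 0 (real N * x $ k - real (i k))\<bar>) \<partial>lborel)"
    by (simp add: cube_bump_def abs_prod prod_ennreal)
  also have "\<dots> = (\<Prod>k\<in>(UNIV :: 'n set). \<integral>\<^sup>+t. ennreal \<bar>b 0 (real N * t - real (i k))\<bar> \<partial>lborel)"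
    by (rule nn_integral_vec_prod) measurable
  also have "\<dots> = ennreal ((bump_mass / real N) ^ CARD('n))"
    using bump_mass_pos by (simp add: 1 ennreal_power)
  finally show ?thesis .
qed

lemma cube_bump_integrable:
  assumes "1 \<le> N" shows "integrable lborel (cube_bump N i (\<lambda>_. 0))"
  by (rule integrableI_bounded) (use assms in \<open>simp_all add: nn_integral_abs_cube_bump\<close>)

text \<open>Each coordinate factor already has mean zero.\<close>

lemma cube_bump_integral_zero:
  assumes "1 \<le> N" shows "integral\<^sup>L lborel (cube_bump N i (\<lambda>_. 0)) = 0"
proof -
  have aff: "(\<lambda>t. b 0 (real N * t - real j)) = (\<lambda>t. b 0 (- real j + real N * t))" for j
    by (simp add: algebra_simps)
  have int: "integrable lborel (\<lambda>t. b 0 (real N * t - real j))" for j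
    unfolding aff using assms by (intro lborel_integrable_real_affine b_integrable) auto
  have "integral\<^sup>L lborel (\<lambda>t. b 0 (real N * t - real j)) = 0" for j
    using lborel_integral_real_affine[of "real N" "b 0" "- real j"] assms b_integral_zero unfolding aff
        by simp
  then show ?thesis
    unfolding cube_bump_def[abs_def] using int
        by (subst lborel_integral_vec_prod) (auto simp: card_gt_0_iff)
qed

definition cell_pert ::
  "real \<Rightarrow> nat \<Rightarrow> nat \<Rightarrow> ('dx \<Rightarrow> nat) \<times> ('dz \<Rightarrow> nat) \<Rightarrow> (real ^ 'dx::finite) \<times> (real ^ 'dz::finite) \<Rightarrow> real" where
  "cell_pert h N K e t = h * cube_bump N (fst e) (\<lambda>_. 0) (fst t) * cube_bump K (snd e) (\<lambda>_. 0) (snd t)"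

lemma cell_pert_disjoint:
  assumes "e \<noteq> e'" shows "cell_pert h N K e t = 0 \<or> cell_pert h N K e' t = 0"
proof (cases "fst e = fst e'")
  case True
  then have "snd e \<noteq> snd e'" using assms by (auto simp: prod_eq_iff)
  then show ?thesis using cube_bump_disjoint[of "snd e" "snd e'" K "\<lambda>_. 0" "snd t" "\<lambda>_. 0"]
      by (auto simp: cell_pert_def)
next
  case False
  then show ?thesis using cube_bump_disjoint[of "fst e" "fst e'" N "\<lambda>_. 0" "fst t" "\<lambda>_. 0"]
      by (auto simp: cell_pert_def)
qed

lemma cell_pert_bound: assumes "0 \<le> h" shows "\<bar>cell_pert h N K e t\<bar> \<le> h"
proof -
  have "\<bar>cell_pert h N K e t\<bar> = h * (\<bar>cube_bump N (fst e) (\<lambda>_. 0) (fst t)\<bar> *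
      \<bar>cube_bump K (snd e) (\<lambda>_. 0) (snd t)\<bar>)"
    using assms by (simp add: cell_pert_def abs_mult)
  also have "\<dots> \<le> h * (1 * 1)"
    using assms by (intro mult_left_mono mult_mono cube_bump_bound) auto
  finally show ?thesis by simp
qed

lemma cell_pert_measurable [measurable]: "cell_pert h N K e \<in> borel_measurable (borel \<Otimes>\<^sub>M borel)"
  unfolding cell_pert_def[abs_def] by measurable

lemma perturbed_measurable [measurable]: "perturbed (cell_pert h N K) A \<in> borel_measurable (borel \<Otimes>\<^sub>M borel)"
  unfolding perturbed_def[abs_def] by measurable

lemma perturbed_ge_half:
  assumes "0 \<le> h" "h \<le> 1/2" shows "1/2 \<le> perturbed (cell_pert h N K) A t"
proof -
  have "\<bar>\<Sum>e\<in>A. cell_pert h N K e t\<bar> \<le> h"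
    by (intro abs_sum_disjoint_le cell_pert_disjoint cell_pert_bound assms)
  then show ?thesis using assms unfolding perturbed_def by linarith
qed

text \<open>For fixed \<open>z\<close> the perturbation is a combination of mean-zero bumps in \<open>x\<close> that live inside the cube.\<close>

lemma perturbed_nn_integral:
  fixes A :: "(('dx::finite \<Rightarrow> nat) \<times> ('dz::finite \<Rightarrow> nat)) set"
  assumes h: "0 \<le> h" "h \<le> 1/2" and N: "1 \<le> N" and A: "\<And>i j k. (i, j) \<in> A \<Longrightarrow> i k < N"
  shows "(\<integral>\<^sup>+x\<in>unit_cube. ennreal (perturbed (cell_pert h N K) A (x, z)) \<partial>lborel) = 1"
proof -
  let ?c = "\<lambda>e. h * cube_bump K (snd e) (\<lambda>_. 0) z"
  let ?f = "\<lambda>x :: real ^ 'dx. indicator unit_cube x + (\<Sum>e\<in>A. ?c e * cube_bump N (fst e) (\<lambda>_. 0) x)"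
  have pert: "cell_pert h N K e (x, z) = ?c e * cube_bump N (fst e) (\<lambda>_. 0) x" for e x
    by (simp add: cell_pert_def)
  have f: "?f x = indicator unit_cube x * perturbed (cell_pert h N K) A (x, z)" for x
  proof (cases "x \<in> unit_cube")
    case True then show ?thesis by (simp add: perturbed_def pert)
  next
    case False
    then have "cube_bump N (fst e) (\<lambda>_. 0) x = 0" if "e \<in> A" for e
      using cube_bump_support[of N "fst e" "\<lambda>_. 0" x] A[of "fst e" "snd e"] that by auto
    then show ?thesis using False by simp
  qed
  have int1: "integrable lborel (indicator unit_cube :: real ^ 'dx \<Rightarrow> real)"
    by (rule integrable_real_indicator) (auto simp: emeasure_lborel_cbox_eq)
  have m1: "measure lborel (unit_cube :: (real ^ 'dx) set) = 1"
    using emeasure_unit_cube by (simp add: measure_def)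
  have intc: "integrable lborel (\<lambda>x. ?c e * cube_bump N (fst e) (\<lambda>_. 0) x)" for e
    by (intro integrable_mult_right cube_bump_integrable N)
  then have int2: "integrable lborel (\<lambda>x. \<Sum>e\<in>A. ?c e * cube_bump N (fst e) (\<lambda>_. 0) x)"
    by (intro Bochner_Integration.integrable_sum)
  have int: "integrable lborel ?f"
    using int1 int2 by (rule Bochner_Integration.integrable_add)
  have "(\<integral>x. (\<Sum>e\<in>A. ?c e * cube_bump N (fst e) (\<lambda>_. 0) x) \<partial>lborel) = 0"
    using intc by (subst Bochner_Integration.integral_sum) (simp_all add: cube_bump_integral_zero[OF N])
  then have "integral\<^sup>L lborel ?f = 1"
    using int1 int2 m1 by (subst Bochner_Integration.integral_add) auto
  moreover have "(\<integral>\<^sup>+x. ennreal (?f x) \<partial>lborel) = ennreal (integral\<^sup>L lborel ?f)"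
  proof (intro nn_integral_eq_integral int AE_I2)
    show "0 \<le> ?f x" for x
      unfolding f using perturbed_ge_half[OF h, of N K A "(x, z)"] by (simp add: indicator_def)
  qed
  moreover have "(\<integral>\<^sup>+x. ennreal (?f x) \<partial>lborel) =
      (\<integral>\<^sup>+x\<in>unit_cube. ennreal (perturbed (cell_pert h N K) A (x, z)) \<partial>lborel)"
    unfolding f by (intro nn_integral_cong) (auto simp: indicator_def)
  ultimately show ?thesis by simp
qed

lemma perturbed_conditional_density:
  fixes A :: "(('dx::finite \<Rightarrow> nat) \<times> ('dz::finite \<Rightarrow> nat)) set"
  assumes h: "0 \<le> h" "h \<le> 1/2" and N: "1 \<le> N" and A: "\<And>i j k. (i, j) \<in> A \<Longrightarrow> i k < N"
  shows "conditional_density (\<lambda>x z. perturbed (cell_pert h N K) A (x, z))"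
proof -
  have "perturbed (cell_pert h N K) A \<in> borel_measurable borel"
    using perturbed_measurable[of h N K A] by (simp add: borel_prod)
  moreover have "(\<lambda>x. perturbed (cell_pert h N K) A (x, z)) \<in> borel_measurable borel" for z
    by measurable
  moreover have "0 \<le> perturbed (cell_pert h N K) A t" for t
    using perturbed_ge_half[OF h, of N K A t] by linarith
  moreover have "(\<integral>\<^sup>+x\<in>unit_cube. ennreal (perturbed (cell_pert h N K) A (x, z)) \<partial>lborel) = 1" for z
    by (rule perturbed_nn_integral[OF h N]) (rule A)
  ultimately show ?thesis
    unfolding conditional_density_def prob_density_on_def set_borel_measurable_def
    by (auto intro!: borel_measurable_times borel_measurable_indicator borel_closed closed_Times)
qed

text \<open>The bound holds pointwise in \<open>x\<close>: there, the perturbation is a sum of disjointly supported functions of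
  \<open>z\<close>, each \<open>h\<close> times a bump with \<open>\<gamma>\<close>-Hoelder constant \<open>2 K\<^sup>\<gamma>\<close>.\<close>

lemma perturbed_tv_smooth:
  fixes A :: "(('dx::finite \<Rightarrow> nat) \<times> ('dz::finite \<Rightarrow> nat)) set"
  assumes h: "0 \<le> h" and \<gamma>: "0 < \<gamma>" "\<gamma> \<le> 1" and W: "4 * h * real K powr \<gamma> \<le> W"
  shows "tv_smooth \<gamma> W (\<lambda>x z. perturbed (cell_pert h N K) A (x, z))"
  unfolding tv_smooth_def
proof (intro ballI)
  fix z z' :: "real ^ 'dz"
  let ?B = "W * l1_norm (z - z') powr \<gamma>"
  have diff: "\<bar>perturbed (cell_pert h N K) A (x, z) - perturbed (cell_pert h N K) A (x, z')\<bar> \<le> ?B" for x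
  proof -
    let ?p = "(real K * l1_norm (z - z')) powr \<gamma>"
    have "\<bar>(\<Sum>e\<in>A. cell_pert h N K e (x, z)) - (\<Sum>e\<in>A. cell_pert h N K e (x, z'))\<bar> \<le> 2 *
        (h * (1 * (2 * ?p)))"
    proof (rule abs_sum_disjoint_diff_le)
      fix e
      have "\<bar>cell_pert h N K e (x, z) - cell_pert h N K e (x, z')\<bar> =
          h * (\<bar>cube_bump N (fst e) (\<lambda>_. 0) x\<bar> * \<bar>cube_bump K (snd e) (\<lambda>_. 0) z - cube_bump K (snd e) (\<lambda>_. 0) z'\<bar>)"
        using h by (simp add: cell_pert_def abs_mult flip: right_diff_distrib)
      also have "\<dots> \<le> h * (1 * (2 * ?p))"
        using h \<gamma> by (intro mult_left_mono mult_mono cube_bump_holder cube_bump_bound) auto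
      finally show "\<bar>cell_pert h N K e (x, z) - cell_pert h N K e (x, z')\<bar> \<le> h * (1 * (2 * ?p))" .
    next
      show "0 \<le> h * (1 * (2 * ?p))" using h by simp
    qed (rule cell_pert_disjoint, assumption)+
    also have "\<dots> = (4 * h * real K powr \<gamma>) * l1_norm (z - z') powr \<gamma>"
      using l1_norm_nonneg by (simp add: powr_mult)
    also have "\<dots> \<le> ?B" using W by (intro mult_right_mono) auto
    finally show ?thesis by (simp add: perturbed_def)
  qed
  have "(\<integral>\<^sup>+x\<in>unit_cube. ennreal \<bar>perturbed (cell_pert h N K) A (x, z) - perturbed (cell_pert h N K) A (x, z')\<bar> \<partial>lborel)
      \<le> (\<integral>\<^sup>+(x :: real ^ 'dx). ennreal ?B * indicator unit_cube x \<partial>lborel)"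
    using diff by (intro nn_integral_mono mult_right_mono ennreal_leI) auto
  also have "\<dots> = ennreal ?B * emeasure lborel (unit_cube :: (real ^ 'dx) set)"
    by (rule nn_integral_cmult_indicator) auto
  also have "\<dots> = ennreal ?B"
    by (simp only: emeasure_unit_cube mult_1_right)
  finally show "(\<integral>\<^sup>+x\<in>unit_cube. ennreal \<bar>perturbed (cell_pert h N K) A (x, z) - perturbed (cell_pert h N K) A (x, z')\<bar> \<partial>lborel) \<le> ennreal ?B" .
qed

text \<open>Each derivative of order \<open>l\<close>, the strict floor of \<open>\<beta>\<close>, is \<open>h N\<^sup>l\<close> times a sum of disjointly supported
  functions with \<open>(\<beta> - l)\<close>-Hoelder constant \<open>2 N\<^bsup>\<beta>-l\<^esup>\<close>, and these powers of \<open>N\<close> multiply to \<open>N\<^sup>\<beta>\<close>.\<close>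

lemma perturbed_holder_smooth:
  fixes A :: "(('dx::finite \<Rightarrow> nat) \<times> ('dz::finite \<Rightarrow> nat)) set"
  assumes h: "0 \<le> h" and \<beta>: "0 < \<beta>" and m: "strict_floor \<beta> \<le> m" and W: "4 * h * real N powr \<beta> \<le>
      W" and N: "1 \<le> N"
  shows "holder_smooth \<beta> W (\<lambda>x z. perturbed (cell_pert h N K) A (x, z))"
  unfolding holder_smooth_def
proof (intro ballI conjI allI impI)
  fix z :: "real ^ 'dz"
  let ?l = "strict_floor \<beta>"
  define c where "c e = h * cube_bump K (snd e) (\<lambda>_. 0) z" for e :: "('dx \<Rightarrow> nat) \<times> ('dz \<Rightarrow> nat)"
  \<comment> \<open>the iterated derivative along \<open>js\<close>; the constant \<open>1\<close> of the density
    survives only if \<open>js\<close> is empty\<close>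
  define f where "f js x = (if js = [] then 1 else 0) + (\<Sum>e\<in>A. c e * real N ^ length js *
      cube_bump N (fst e) (count_list js) x)"
    for js and x :: "real ^ 'dx"
  have [simp]: "count_list [] = (\<lambda>_ :: 'dx. 0)" by auto
  have f_Nil: "f [] = (\<lambda>x. perturbed (cell_pert h N K) A (x, z))"
    by (simp add: f_def[abs_def] perturbed_def cell_pert_def c_def mult_ac)
  have count: "count_list js k \<le> length js" for js :: "'dx list" and k by (induction js) auto
  have deriv: "(f js has_derivative (\<lambda>v. \<Sum>i\<in>UNIV. v $ i * f (i # js) x)) (at x within unit_cube)"
    if "length js < ?l" for js x
  proof -
    have cnt: "count_list js k \<le> m" for k using count[of js k] that m by linarith
    have upd: "(count_list js)(k := Suc (count_list js k)) = count_list (k # js)" for k by auto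
    have dcb: "(cube_bump N i (count_list js) has_derivative
        (\<lambda>v. \<Sum>k\<in>UNIV. v $ k * (real N * cube_bump N i (count_list (k # js)) x))) (at x within unit_cube)" for i
      using cube_bump_has_derivative[where \<alpha>="count_list js" and N=N and i=i, OF cnt]
          by (simp only: upd)
    have "(f js has_derivative (\<lambda>v. 0 + (\<Sum>e\<in>A. c e * real N ^ length js *
        (\<Sum>k\<in>UNIV. v $ k * (real N * cube_bump N (fst e) (count_list (k # js)) x))))) (at x within unit_cube)"
      unfolding f_def[abs_def]
      by (intro has_derivative_add has_derivative_const has_derivative_sum has_derivative_mult_right
        dcb)
    moreover have "0 + (\<Sum>e\<in>A. c e * real N ^ length js *
        (\<Sum>k\<in>UNIV. v $ k * (real N * cube_bump N (fst e) (count_list (k # js)) x))) = (\<Sum>i\<in>UNIV. v $ i * f (i # js) x)" for v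
    proof -
      have "(\<Sum>i\<in>UNIV. v $ i * f (i # js) x) =
          (\<Sum>i\<in>UNIV. \<Sum>e\<in>A. v $ i * (c e * real N ^ Suc (length js) * cube_bump N (fst e) (count_list (i # js)) x))"
        by (simp only: f_def list.simps list.size if_False sum_distrib_left add_0 Suc_eq_plus1 add.commute) simp
      also have "\<dots> = (\<Sum>e\<in>A. \<Sum>i\<in>UNIV. v $ i * (c e * real N ^ Suc (length js) *
          cube_bump N (fst e) (count_list (i # js)) x))"
        by (rule sum.swap)
      also have "\<dots> = (\<Sum>e\<in>A. c e * real N ^ length js *
        (\<Sum>k\<in>UNIV. v $ k * (real N * cube_bump N (fst e) (count_list (k # js)) x)))"
        unfolding sum_distrib_left by (intro sum.cong refl) (simp only: power_Suc mult_ac)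
      finally show ?thesis by simp
    qed
    ultimately show ?thesis by (simp only:)
  qed
  show "times_differentiable_on ?l unit_cube (\<lambda>x. perturbed (cell_pert h N K) A (x, z))"
    unfolding f_Nil[symmetric] by (rule derivative_family(1)) (rule deriv)
  fix x x' :: "real ^ 'dx" and \<alpha> :: "'dx \<Rightarrow> nat"
  assume x: "x \<in> unit_cube" "x' \<in> unit_cube" and \<alpha>: "(\<Sum>i\<in>UNIV. \<alpha> i) = ?l"
  obtain js where js: "length js = ?l" "\<And>S f. multi_deriv S \<alpha> f = foldr (partial_deriv S) js f"
    using multi_deriv_obtain[of \<alpha>] \<alpha> by metis
  have md: "multi_deriv unit_cube \<alpha> (\<lambda>x. perturbed (cell_pert h N K) A (x, z)) y = f js y"
      if "y \<in> unit_cube" for y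
    unfolding f_Nil[symmetric] js(2) using js(1) that
        by (intro derivative_family(2)[where k="?l"] deriv) auto
  define \<theta> where "\<theta> = \<beta> - real ?l"
  have \<theta>: "0 < \<theta>" "\<theta> \<le> 1" using strict_floor_bounds[OF \<beta>] by (auto simp: \<theta>_def)
  let ?p = "(real N * l1_norm (x - x')) powr \<theta>"
  have cnt: "count_list js k \<le> m" for k using count[of js k] js(1) m by linarith
  have c: "\<bar>c e\<bar> \<le> h" for e
    using mult_left_mono[OF cube_bump_bound[of "\<lambda>_. 0" K "snd e" z] h] h by (simp add: c_def abs_mult)
  have "\<bar>f js x - f js x'\<bar> = \<bar>(\<Sum>e\<in>A. c e * real N ^ ?l * cube_bump N (fst e) (count_list js) x) -
      (\<Sum>e\<in>A. c e * real N ^ ?l * cube_bump N (fst e) (count_list js) x')\<bar>"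
    by (simp add: f_def js(1))
  also have "\<dots> \<le> 2 * (h * real N ^ ?l * (2 * ?p))"
  proof (rule abs_sum_disjoint_diff_le)
    have *: "c e * real N ^ ?l * cube_bump N (fst e) (count_list js) y = 0 \<or>
          c e' * real N ^ ?l * cube_bump N (fst e') (count_list js) y = 0" if "e \<noteq> e'" for e e' y
    proof (cases "fst e = fst e'")
      case True
      then have "snd e \<noteq> snd e'" using that by (auto simp: prod_eq_iff)
      then show ?thesis using cube_bump_disjoint[of "snd e" "snd e'" K "\<lambda>_. 0" z "\<lambda>_. 0"]
          by (auto simp: c_def)
    next
      case False
      then show ?thesis
          using cube_bump_disjoint[of "fst e" "fst e'" N "count_list js" y "count_list js"] by auto
    qed
    show "c e * real N ^ ?l * cube_bump N (fst e) (count_list js) x = 0 \<or>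
          c e' * real N ^ ?l * cube_bump N (fst e') (count_list js) x = 0" if "e \<noteq> e'" for e e'
      using that by (rule *)
    show "c e * real N ^ ?l * cube_bump N (fst e) (count_list js) x' = 0 \<or>
          c e' * real N ^ ?l * cube_bump N (fst e') (count_list js) x' = 0" if "e \<noteq> e'" for e e'
      using that by (rule *)
    fix e
    have "\<bar>c e * real N ^ ?l * cube_bump N (fst e) (count_list js) x - c e * real N ^ ?l *
        cube_bump N (fst e) (count_list js) x'\<bar>
      = \<bar>c e\<bar> * real N ^ ?l * \<bar>cube_bump N (fst e) (count_list js) x - cube_bump N (fst e) (count_list js) x'\<bar>"
      by (simp add: abs_mult flip: right_diff_distrib)
    also have "\<dots> \<le> h * real N ^ ?l * (2 * ?p)"
      using h c \<theta> cnt by (intro mult_mono mult_right_mono cube_bump_holder) auto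
    finally show "\<bar>c e * real N ^ ?l * cube_bump N (fst e) (count_list js) x - c e * real N ^ ?l *
        cube_bump N (fst e) (count_list js) x'\<bar>
      \<le> h * real N ^ ?l * (2 * ?p)" .
  qed (use h in auto)
  also have "\<dots> = (4 * h * (real N ^ ?l * real N powr \<theta>)) * l1_norm (x - x') powr \<theta>"
    using l1_norm_nonneg by (simp add: powr_mult)
  also have "real N ^ ?l * real N powr \<theta> = real N powr \<beta>"
    using N by (simp add: \<theta>_def powr_realpow[symmetric] flip: powr_add)
  also have "(4 * h * real N powr \<beta>) * l1_norm (x - x') powr \<theta> \<le> W * l1_norm (x - x') powr \<theta>"
    using W by (intro mult_right_mono) auto
  finally show "\<bar>multi_deriv unit_cube \<alpha> (\<lambda>x. perturbed (cell_pert h N K) A (x, z)) x -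
      multi_deriv unit_cube \<alpha> (\<lambda>x. perturbed (cell_pert h N K) A (x, z)) x'\<bar> \<le> W * l1_norm (x - x') powr (\<beta> - real ?l)"
    using x by (simp add: md \<theta>_def)
qed

end

section \<open>Risk as an integral over the reference law\<close>

lemma prob_density_weight:
  assumes "prob_density_on unit_cube p"
  shows "(\<lambda>z. ennreal (p z) * indicator unit_cube z) \<in> borel_measurable borel"
    and "(\<integral>\<^sup>+z. ennreal (p z) * indicator unit_cube z \<partial>lborel) = 1"
proof -
  have "(\<lambda>z. indicator unit_cube z *\<^sub>R p z) \<in> borel_measurable borel"
    using assms by (simp add: prob_density_on_def set_borel_measurable_def)
  then have "(\<lambda>z. ennreal (indicator unit_cube z *\<^sub>R p z)) \<in> borel_measurable borel" by measurable
  also have "(\<lambda>z. ennreal (indicator unit_cube z *\<^sub>R p z)) = (\<lambda>z. ennreal (p z) * indicator unit_cube z)"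
    by (auto simp: indicator_def)
  finally show "(\<lambda>z. ennreal (p z) * indicator unit_cube z) \<in> borel_measurable borel" .
qed (use assms in \<open>simp add: prob_density_on_def\<close>)

text \<open>The conditional density \<open>1\<close> makes \<open>X\<close> uniform on the cube and independent of \<open>Z\<close>.  This law is the
  reference measure with respect to which all densities are taken.\<close>

lemma nn_integral_base_law:
  fixes p :: "real ^ 'dz \<Rightarrow> real" and f :: "(real ^ 'dx) \<times> (real ^ 'dz) \<Rightarrow> ennreal"
  assumes p: "prob_density_on unit_cube p" and f[measurable]: "f \<in> borel_measurable (borel \<Otimes>\<^sub>M borel)"
  shows "(\<integral>\<^sup>+t. f t \<partial>joint_law (\<lambda>_ _. 1) p) =
    (\<integral>\<^sup>+z. (\<integral>\<^sup>+x\<in>unit_cube. f (x, z) \<partial>lborel) * (ennreal (p z) * indicator unit_cube z) \<partial>lborel)"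
proof -
  note w[measurable] = prob_density_weight(1)[OF p]
  have d: "(\<lambda>(x, z). ennreal (1 * p z) * indicator (unit_cube \<times> unit_cube) (x, z)) =
      (\<lambda>t :: (real ^ 'dx) \<times> (real ^ 'dz). indicator unit_cube (fst t) * (ennreal (p (snd t)) * indicator unit_cube (snd t)))"
    by (auto simp: indicator_def)
  have "(\<integral>\<^sup>+t. f t \<partial>joint_law (\<lambda>_ _. 1) p) =
      (\<integral>\<^sup>+t. indicator unit_cube (fst t) * (ennreal (p (snd t)) * indicator unit_cube (snd t)) * f t \<partial>(lborel \<Otimes>\<^sub>M lborel))"
    unfolding joint_law_def d lborel_prod[symmetric] by (rule nn_integral_density) measurable
  also have "\<dots> = (\<integral>\<^sup>+z. \<integral>\<^sup>+x. indicator unit_cube x * (ennreal (p z) * indicator unit_cube z) *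
      f (x, z) \<partial>lborel \<partial>lborel)"
    by (subst lborel_pair.nn_integral_snd[symmetric]) simp_all
  also have "\<dots> = (\<integral>\<^sup>+z. (\<integral>\<^sup>+x\<in>unit_cube. f (x, z) \<partial>lborel) *
      (ennreal (p z) * indicator unit_cube z) \<partial>lborel)"
    by (intro nn_integral_cong, subst nn_integral_multc[symmetric]) (auto simp: mult_ac)
  finally show ?thesis .
qed

lemma sets_joint_law: "sets (joint_law q p) = sets (borel \<Otimes>\<^sub>M borel)"
  by (simp add: joint_law_def flip: borel_prod)

lemma joint_law_eq_density:
  fixes p :: "real ^ 'dz \<Rightarrow> real" and q :: "(real ^ 'dx) \<times> (real ^ 'dz) \<Rightarrow> real"
  assumes p: "prob_density_on unit_cube p" and [measurable]: "q \<in> borel_measurable (borel \<Otimes>\<^sub>M borel)"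
    and q0: "\<And>t. 0 \<le> q t"
  shows "joint_law (\<lambda>x z. q (x, z)) p = density (joint_law (\<lambda>_ _. 1) p) (\<lambda>t. ennreal (q t))"
proof -
  note w[measurable] = prob_density_weight(1)[OF p]
  have d: "(\<lambda>(x, z). ennreal (1 * p z) * indicator (unit_cube \<times> unit_cube) (x, z)) =
      (\<lambda>t :: (real ^ 'dx) \<times> (real ^ 'dz). indicator unit_cube (fst t) * (ennreal (p (snd t)) * indicator unit_cube (snd t)))"
    by (auto simp: indicator_def)
  have "density (joint_law (\<lambda>_ _. 1) p) (\<lambda>t. ennreal (q t)) =
      density (lborel \<Otimes>\<^sub>M lborel) (\<lambda>t. indicator unit_cube (fst t) * (ennreal (p (snd t)) * indicator unit_cube (snd t)) * ennreal (q t))"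
    unfolding joint_law_def d lborel_prod[symmetric] by (rule density_density_eq) measurable
  also have "(\<lambda>t. indicator unit_cube (fst t) * (ennreal (p (snd t)) * indicator unit_cube (snd t)) *
      ennreal (q t)) =
      (\<lambda>(x, z). ennreal (q (x, z) * p z) * indicator (unit_cube \<times> unit_cube) (x, z))"
    using p q0 by (auto simp: indicator_def prob_density_on_def ennreal_mult mult_ac)
  finally show ?thesis by (simp add: joint_law_def lborel_prod)
qed

lemma prob_space_base_law:
  assumes "prob_density_on unit_cube p"
  shows "prob_space (joint_law (\<lambda>(_ :: real ^ 'dx) _. 1) p)"
proof
  have "emeasure (joint_law (\<lambda>(_ :: real ^ 'dx) _. 1) p) (space (joint_law (\<lambda>(_ :: real ^ 'dx) _. 1) p)) =
      (\<integral>\<^sup>+t. 1 \<partial>joint_law (\<lambda>(_ :: real ^ 'dx) _. 1) p)" by simp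
  also have "\<dots> = 1"
    using prob_density_weight(2)[OF assms]
        by (subst nn_integral_base_law[OF assms]) (simp_all add: emeasure_unit_cube)
  finally show "emeasure (joint_law (\<lambda>(_ :: real ^ 'dx) _. 1) p) (space (joint_law (\<lambda>(_ :: real ^ 'dx) _. 1) p)) = 1" .
qed

lemma estimator_measurable:
  fixes p_hat :: "('dx::finite, 'dz::finite) estimator"
  assumes "p_hat \<in> estimators n"
  shows "(\<lambda>(s, t). p_hat s (fst t) (snd t)) \<in>
    borel_measurable ((\<Pi>\<^sub>M i\<in>{..<n}. joint_law (\<lambda>_ _. 1) p) \<Otimes>\<^sub>M joint_law (\<lambda>_ _. 1) p)"
proof -
  let ?P = "joint_law (\<lambda>_ _. 1) p :: ((real ^ 'dx) \<times> (real ^ 'dz)) measure"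
  have "sets (\<Pi>\<^sub>M i\<in>{..<n}. ?P) = sets (\<Pi>\<^sub>M i\<in>{..<n}. (borel :: ((real ^ 'dx) \<times> (real ^ 'dz)) measure))"
    by (intro sets_PiM_cong refl) (simp only: sets_joint_law borel_prod)
  then have s: "sets ((\<Pi>\<^sub>M i\<in>{..<n}. ?P) \<Otimes>\<^sub>M ?P) =
      sets ((\<Pi>\<^sub>M i\<in>{..<n}. (borel :: ((real ^ 'dx) \<times> (real ^ 'dz)) measure)) \<Otimes>\<^sub>M (borel \<Otimes>\<^sub>M borel))"
    by (intro sets_pair_measure_cong) (auto simp: sets_joint_law)
  have "(\<lambda>(s, t). p_hat s (fst t) (snd t)) = (\<lambda>(s, x, z). p_hat s x z)" by auto
  then show ?thesis
    using assms by (simp add: estimators_def measurable_cong_sets[OF s refl])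
qed

text \<open>The weight \<open>p z\<close> in the loss is the density of the reference law, so that the loss is an \<open>L\<^sup>1\<close> distance
  over the same measure that dominates the samples, as Assouad's lemma requires.\<close>

lemma risk_eq:
  fixes p_hat :: "('dx::finite, 'dz::finite) estimator"
  assumes p: "prob_density_on unit_cube p" and p_hat: "p_hat \<in> estimators n"
    and q[measurable]: "q \<in> borel_measurable (borel \<Otimes>\<^sub>M borel)" and q0: "\<And>t. 0 \<le> q t"
  shows "risk n p_hat (\<lambda>x z. q (x, z)) p =
    (\<integral>\<^sup>+s. (\<integral>\<^sup>+t. ennreal \<bar>p_hat s (fst t) (snd t) - q t\<bar> \<partial>joint_law (\<lambda>_ _. 1) p)
      \<partial>(\<Pi>\<^sub>M i\<in>{..<n}. density (joint_law (\<lambda>_ _. 1) p) (\<lambda>t. ennreal (q t))))"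
  unfolding risk_def joint_law_eq_density[OF p q q0]
proof (intro nn_integral_cong)
  let ?P = "joint_law (\<lambda>_ _. 1) p :: ((real ^ 'dx) \<times> (real ^ 'dz)) measure"
  fix s assume "s \<in> space (\<Pi>\<^sub>M i\<in>{..<n}. density ?P (\<lambda>t. ennreal (q t)))"
  then have s: "s \<in> space (\<Pi>\<^sub>M i\<in>{..<n}. ?P)" by (simp add: space_PiM)
  have "(\<lambda>t. p_hat s (fst t) (snd t)) \<in> borel_measurable ?P"
    using measurable_compose[OF measurable_Pair1'[OF s] estimator_measurable[OF p_hat, of p]] by simp
  then have g[measurable]: "(\<lambda>t. p_hat s (fst t) (snd t)) \<in> borel_measurable (borel \<Otimes>\<^sub>M borel)"
    by (simp add: measurable_cong_sets[OF sets_joint_law refl])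
  have "(\<integral>\<^sup>+t. ennreal \<bar>p_hat s (fst t) (snd t) - q t\<bar> \<partial>?P) =
    (\<integral>\<^sup>+z. (\<integral>\<^sup>+x\<in>unit_cube. ennreal \<bar>p_hat s x z - q (x, z)\<bar> \<partial>lborel) * (ennreal (p z) * indicator unit_cube z) \<partial>lborel)"
    by (subst nn_integral_base_law[OF p]) simp_all
  also have "\<dots> =
      (\<integral>\<^sup>+z\<in>unit_cube. (\<integral>\<^sup>+x\<in>unit_cube. ennreal (\<bar>p_hat s x z - q (x, z)\<bar> * p z) \<partial>lborel) \<partial>lborel)"
  proof (intro nn_integral_cong)
    fix z :: "real ^ 'dz"
    have "(\<lambda>x. p_hat s (fst (x, z)) (snd (x, z))) \<in> borel_measurable borel" by measurable
    then have [measurable]: "(\<lambda>x. p_hat s x z) \<in> borel_measurable borel" by simp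
    show "(\<integral>\<^sup>+x\<in>unit_cube. ennreal \<bar>p_hat s x z - q (x, z)\<bar> \<partial>lborel) *
        (ennreal (p z) * indicator unit_cube z) =
      (\<integral>\<^sup>+x\<in>unit_cube. ennreal (\<bar>p_hat s x z - q (x, z)\<bar> * p z) \<partial>lborel) * indicator unit_cube z"
    proof (cases "z \<in> unit_cube")
      case True
      then have "0 \<le> p z" using p by (auto simp: prob_density_on_def)
      then have "(\<integral>\<^sup>+x\<in>unit_cube. ennreal (\<bar>p_hat s x z - q (x, z)\<bar> * p z) \<partial>lborel) =
          (\<integral>\<^sup>+x. (ennreal \<bar>p_hat s x z - q (x, z)\<bar> * indicator unit_cube x) * ennreal (p z) \<partial>lborel)"
        by (intro nn_integral_cong) (simp add: ennreal_mult mult_ac)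
      also have "\<dots> = (\<integral>\<^sup>+x\<in>unit_cube. ennreal \<bar>p_hat s x z - q (x, z)\<bar> \<partial>lborel) * ennreal (p z)"
        by (rule nn_integral_multc) measurable
      finally show ?thesis using True by simp
    qed simp
  qed
  finally show "(\<integral>\<^sup>+z\<in>unit_cube. (\<integral>\<^sup>+x\<in>unit_cube. ennreal (\<bar>p_hat s x z - q (x, z)\<bar> *
      p z) \<partial>lborel) \<partial>lborel) =
    (\<integral>\<^sup>+t. ennreal \<bar>p_hat s (fst t) (snd t) - q t\<bar> \<partial>?P)" by simp
qed

section \<open>Light cells and the size of the grid\<close>

text \<open>Markov's inequality for the uniform distribution on \<open>I\<close>.\<close>

lemma half_of_cells_light:
  fixes f :: "'a \<Rightarrow> ennreal"
  assumes "finite I" "(\<Sum>i\<in>I. f i) \<le> 1"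
  shows "card I \<le> 2 * card {i\<in>I. of_nat (card I) * f i \<le> 2}"
proof -
  let ?J = "{i\<in>I. of_nat (card I) * f i \<le> 2}"
  have "of_nat (2 * card (I - ?J)) = (\<Sum>i\<in>I - ?J. 2 :: ennreal)" by (simp add: mult.commute)
  also have "\<dots> \<le> (\<Sum>i\<in>I - ?J. of_nat (card I) * f i)" by (intro sum_mono) auto
  also have "\<dots> \<le> (\<Sum>i\<in>I. of_nat (card I) * f i)" using assms(1) by (intro sum_mono2) auto
  also have "\<dots> = of_nat (card I) * (\<Sum>i\<in>I. f i)" by (simp add: sum_distrib_left)
  also have "\<dots> \<le> of_nat (card I) * 1" using assms(2) by (intro mult_left_mono) auto
  finally have "2 * card (I - ?J) \<le> card I" by (simp only: mult_1_right of_nat_le_iff)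
  moreover have "card (I - ?J) = card I - card ?J" using assms(1) by (intro card_Diff_subset) auto
  moreover have "card ?J \<le> card I" using assms(1) by (intro card_mono) auto
  ultimately show ?thesis by linarith
qed

definition grid :: "nat \<Rightarrow> ('n::finite \<Rightarrow> nat) set" where
  "grid N = (\<Pi>\<^sub>E k\<in>UNIV. {..<N})"

lemma finite_grid: "finite (grid N)"
  unfolding grid_def by (intro finite_PiE) auto

lemma card_grid: "card (grid N :: ('n::finite \<Rightarrow> nat) set) = N ^ CARD('n)"
  unfolding grid_def by (subst card_PiE) auto

lemma grid_lt: "i \<in> grid N \<Longrightarrow> i k < N"
  by (auto simp: grid_def)

text \<open>With \<open>r\<close> the \<open>D\<close>-th root of \<open>n\<close>, round \<open>r\<^bsup>1/\<beta>\<^esup>\<close> and \<open>r\<^bsup>1/\<gamma>\<^esup>\<close> up to \<open>N\<close> and \<open>K\<close>, which at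
  most doubles them.  The third bound is the balance between the smoothness in \<open>x\<close> and in \<open>z\<close>, the fourth
  makes neighbouring densities indistinguishable, as \<open>n = r\<^sup>D\<close> and
  \<open>D - 2 = dx/\<beta> + dz/\<gamma>\<close>, and the fifth is the rate.\<close>

lemma grid_sizes_exist:
  fixes \<beta> \<gamma> :: real and dx dz n :: nat
  assumes \<beta>: "0 < \<beta>" and \<gamma>: "0 < \<gamma>" "\<gamma> \<le> 1" and n: "1 \<le> n"
  defines "D \<equiv> inverse \<beta> * real dx + inverse \<gamma> * real dz + 2"
  obtains N K :: nat where "1 \<le> N" "1 \<le> K"
    "real N powr - \<beta> * real K powr \<gamma> \<le> 2"
    "real n * (real N powr - \<beta>)\<^sup>2 \<le> real N ^ dx * real K ^ dz"
    "2 powr - \<beta> * real n powr (- 1 / D) \<le> real N powr - \<beta>"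
proof -
  have D: "0 < D" using \<beta> \<gamma> by (auto simp: D_def intro!: add_nonneg_pos)
  define r where "r = real n powr (1 / D)"
  have r1: "1 \<le> r" unfolding r_def using n D by (intro ge_one_powr_ge_zero) auto
  have rD: "r powr D = real n" using n D by (simp add: r_def powr_powr)
  have ex: "\<exists>k::nat. 1 \<le> k \<and> r powr inverse a \<le> real k \<and> real k \<le> 2 * r powr inverse a" if "0 < a" for a
  proof -
    have 1: "1 \<le> r powr inverse a" using r1 that by (intro ge_one_powr_ge_zero) auto
    let ?k = "nat \<lceil>r powr inverse a\<rceil>"
    have k: "r powr inverse a \<le> real ?k" "real ?k \<le> r powr inverse a + 1" using 1 by linarith+
    then have "1 \<le> real ?k" using 1 by linarith
    then show ?thesis using k 1 by (intro exI[of _ ?k]) linarith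
  qed
  obtain N where N: "1 \<le> N" "r powr inverse \<beta> \<le> real N" "real N \<le> 2 * r powr inverse \<beta>" using ex[OF \<beta>]
      by auto
  obtain K where K: "1 \<le> K" "r powr inverse \<gamma> \<le> real K" "real K \<le> 2 * r powr inverse \<gamma>"
      using ex[OF \<gamma>(1)] by auto
  have inv: "(r powr inverse a) powr a = r" if "0 < a" for a using r1 that by (simp add: powr_powr)
  have N_lo: "r \<le> real N powr \<beta>"
    using powr_mono2[OF _ _ N(2), of \<beta>] \<beta> by (simp add: inv)
  have N_hi: "real N powr \<beta> \<le> 2 powr \<beta> * r"
    using powr_mono2[OF _ _ N(3), of \<beta>] \<beta> by (simp add: powr_mult inv)
  have "real K powr \<gamma> \<le> 2 powr \<gamma> * r"
    using powr_mono2[OF _ _ K(3), of \<gamma>] \<gamma> by (simp add: powr_mult inv)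
  also have "\<dots> \<le> 2 powr 1 * r" using \<gamma> r1 by (intro mult_right_mono powr_mono) auto
  finally have K_hi: "real K powr \<gamma> \<le> 2 * r" by simp
  have Nb: "0 < real N powr \<beta>" using N(1) by simp
  show ?thesis
  proof (rule that[OF N(1) K(1)])
    have "real K powr \<gamma> \<le> 2 * real N powr \<beta>" using K_hi N_lo by linarith
    then show "real N powr - \<beta> * real K powr \<gamma> \<le> 2" using Nb by (simp add: powr_minus field_simps)
    have "real n * (real N powr - \<beta>)\<^sup>2 \<le> real n * (inverse r)\<^sup>2"
      using N_lo r1
          by (intro mult_left_mono power_mono) (auto simp: powr_minus intro!: le_imp_inverse_le)
    also have "\<dots> = r powr (inverse \<beta> * real dx) * r powr (inverse \<gamma> * real dz)"
      using r1 unfolding rD[symmetric] by (simp add: D_def powr_add powr_numeral field_simps)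
    also have "\<dots> = (r powr inverse \<beta>) ^ dx * (r powr inverse \<gamma>) ^ dz"
      using r1 by (simp add: powr_powr[symmetric] powr_realpow)
    also have "\<dots> \<le> real N ^ dx * real K ^ dz"
      using N K by (intro mult_mono power_mono) auto
    finally show "real n * (real N powr - \<beta>)\<^sup>2 \<le> real N ^ dx * real K ^ dz" .
    have "2 powr - \<beta> * real n powr (- 1 / D) = inverse (2 powr \<beta> * r)"
      by (simp add: r_def powr_minus inverse_mult_distrib flip: powr_minus)
    also have "\<dots> \<le> inverse (real N powr \<beta>)" using N_hi Nb by (intro le_imp_inverse_le)
    finally show "2 powr - \<beta> * real n powr (- 1 / D) \<le> real N powr - \<beta>" by (simp add: powr_minus)
  qed
qed

section \<open>The minimax lower bound\<close>

context bump_tower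
begin

text \<open>Only product cells whose \<open>z\<close>-part carries at most twice the average mass are perturbed.  They make up at
  least half of all cells, and each of them contributes an error of order \<open>h c\<close> times its volume.\<close>

lemma risk_lower_bound:
  fixes p :: "real ^ 'dz::finite \<Rightarrow> real" and p_hat :: "('dx::finite, 'dz) estimator"
  assumes p: "prob_density_on unit_cube p" and c: "0 < c" "\<And>z. z \<in> unit_cube \<Longrightarrow> c \<le> p z"
    and h: "0 \<le> h" "h \<le> 1/2" and NK: "1 \<le> N" "1 \<le> K" and n: "1 \<le> n"
    and hn: "real n * h\<^sup>2 * 2 \<le> real N ^ CARD('dx) * real K ^ CARD('dz)"
    and p_hat: "p_hat \<in> estimators n"
  shows "\<exists>A\<subseteq>grid N \<times> grid K. ennreal (h * c * bump_mass ^ CARD('dx) * bump_mass ^ CARD('dz) / 32) \<le>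
    risk n p_hat (\<lambda>x z. perturbed (cell_pert h N K) A (x, z)) p"
proof -
  let ?P = "joint_law (\<lambda>_ _. 1) p :: ((real ^ 'dx) \<times> (real ^ 'dz)) measure"
  let ?u = "cell_pert h N K :: ('dx \<Rightarrow> nat) \<times> ('dz \<Rightarrow> nat) \<Rightarrow> (real ^ 'dx) \<times> (real ^ 'dz) \<Rightarrow> real"
  let ?dx = "CARD('dx)" and ?dz = "CARD('dz)"
  define w where "w z = ennreal (p z) * indicator unit_cube z" for z
  have w[measurable]: "w \<in> borel_measurable borel" and w1: "(\<integral>\<^sup>+z. w z \<partial>lborel) = 1"
    using prob_density_weight[OF p] by (auto simp: w_def[abs_def])
  define S where "S j = {z :: real ^ 'dz. cube_bump K j (\<lambda>_. 0) z \<noteq> 0}" for j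
  have S[measurable]: "S j \<in> sets borel" for j
  proof -
    have "{z \<in> space borel. cube_bump K j (\<lambda>_. 0) (z :: real ^ 'dz) \<noteq> 0} \<in> sets borel" by measurable
    then show ?thesis by (simp add: S_def)
  qed
  \<comment> \<open>\<open>\<mu> j\<close> is the mass that the law of \<open>Z\<close> gives to the cell \<open>j\<close>, and \<open>J\<close> is the set of light cells.\<close>
  define \<mu> where "\<mu> j = (\<integral>\<^sup>+z. w z * indicator (S j) z \<partial>lborel)" for j
  define J where "J = {j \<in> grid K. of_nat (card (grid K :: ('dz \<Rightarrow> nat) set)) * \<mu> j \<le> 2}"
  have "(\<Sum>j\<in>grid K. \<mu> j) = (\<integral>\<^sup>+z. (\<Sum>j\<in>grid K. w z * indicator (S j) z) \<partial>lborel)"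
    unfolding \<mu>_def by (rule nn_integral_sum[symmetric]) measurable
  also have "\<dots> = (\<integral>\<^sup>+z. w z * indicator (\<Union>j\<in>grid K. S j) z \<partial>lborel)"
  proof (intro nn_integral_cong)
    fix z
    have "disjoint_family_on S (grid K)"
      unfolding disjoint_family_on_def S_def using cube_bump_disjoint by blast
    then show "(\<Sum>j\<in>grid K. w z * indicator (S j) z) = w z * indicator (\<Union>j\<in>grid K. S j) z"
      by (subst indicator_UN_disjoint) (auto simp: finite_grid sum_distrib_left)
  qed
  also have "\<dots> \<le> (\<integral>\<^sup>+z. w z \<partial>lborel)"
    by (intro nn_integral_mono) (auto simp: indicator_def)
  finally have "card (grid K :: ('dz \<Rightarrow> nat) set) \<le> 2 * card J"
    unfolding J_def w1 using finite_grid by (intro half_of_cells_light) auto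
  then have J_card: "K ^ ?dz \<le> 2 * card J" by (simp add: card_grid)
  have J_grid: "J \<subseteq> grid K" by (auto simp: J_def)
  define E where "E = (grid N :: ('dx \<Rightarrow> nat) set) \<times> J"
  have E_fin: "finite E" 
    unfolding E_def by (intro finite_cartesian_product finite_grid finite_subset[OF J_grid])
  have E_card: "card E = N ^ ?dx * card J" by (simp add: E_def card_cartesian_product card_grid)
  have E_sub: "E \<subseteq> grid N \<times> grid K" using J_grid by (auto simp: E_def)
  define \<delta> where "\<delta> = h * c * (bump_mass / real N) ^ ?dx * (bump_mass / real K) ^ ?dz"
  have \<kappa>: "0 < bump_mass" by (rule bump_mass_pos)
  have u_meas: "?u e \<in> borel_measurable ?P" for e
    by (simp add: measurable_cong_sets[OF sets_joint_law refl])
  have chi: "of_nat n * (\<integral>\<^sup>+t. ennreal ((?u e t)\<^sup>2) \<partial>?P) \<le> 1" if "e \<in> E" for e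
  proof -
    obtain i j where e: "e = (i, j)" and j: "j \<in> J" using \<open>e \<in> E\<close> by (auto simp: E_def)
    have "of_nat (K ^ ?dz) * \<mu> j \<le> 2" using j by (simp only: J_def card_grid mem_Collect_eq)
    then have Kmu: "ennreal (real K ^ ?dz) * \<mu> j \<le> 2" by (simp add: ennreal_of_nat_eq_real_of_nat)
    \<comment> \<open>The bumps are at most \<open>1\<close> in modulus, so a squared bump is below its modulus and below the
      indicator of its support.\<close>
    have bound: "(?u e (x, z))\<^sup>2 \<le> h\<^sup>2 * \<bar>cube_bump N i (\<lambda>_. 0) x\<bar> * indicator (S j) z" for x z
    proof -
      have "(cube_bump N i (\<lambda>_. 0) x)\<^sup>2 \<le> \<bar>cube_bump N i (\<lambda>_. 0) x\<bar>"
        using cube_bump_bound[of "\<lambda>_. 0" N i x] power_decreasing[of 1 2 "\<bar>cube_bump N i (\<lambda>_. 0) x\<bar>"]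
            by simp
      moreover have "(cube_bump K j (\<lambda>_. 0) z)\<^sup>2 \<le> indicator (S j) z"
        using cube_bump_bound[of "\<lambda>_. 0" K j z] by (auto simp: S_def indicator_def abs_square_le_1)
      ultimately show ?thesis
        unfolding e cell_pert_def power_mult_distrib fst_conv snd_conv
        by (intro mult_mono mult_left_mono) auto
    qed
    have "(\<integral>\<^sup>+t. ennreal ((?u e t)\<^sup>2) \<partial>?P) = (\<integral>\<^sup>+z. (\<integral>\<^sup>+x\<in>unit_cube. ennreal ((?u e (x, z))\<^sup>2) \<partial>lborel) *
        w z \<partial>lborel)"
      unfolding w_def by (rule nn_integral_base_law[OF p]) measurable
    also have "\<dots> \<le> (\<integral>\<^sup>+z. ennreal (h\<^sup>2 * (bump_mass / real N) ^ ?dx) * (w z * indicator (S j) z) \<partial>lborel)"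
    proof (intro nn_integral_mono)
      fix z :: "real ^ 'dz"
      have "(\<integral>\<^sup>+x\<in>unit_cube. ennreal ((?u e (x, z))\<^sup>2) \<partial>lborel) \<le>
          (\<integral>\<^sup>+x. ennreal (h\<^sup>2) * indicator (S j) z * ennreal \<bar>cube_bump N i (\<lambda>_. 0) (x :: real ^ 'dx)\<bar> \<partial>lborel)"
      proof (intro nn_integral_mono)
        fix x :: "real ^ 'dx"
        have "ennreal ((?u e (x, z))\<^sup>2) * indicator unit_cube x \<le> ennreal ((?u e (x, z))\<^sup>2)"
          by (auto simp: indicator_def)
        also have "\<dots> \<le> ennreal (h\<^sup>2 * \<bar>cube_bump N i (\<lambda>_. 0) x\<bar> * indicator (S j) z)"
          using bound by (rule ennreal_leI)
        also have "\<dots> = ennreal (h\<^sup>2) * indicator (S j) z * ennreal \<bar>cube_bump N i (\<lambda>_. 0) x\<bar>"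
          by (auto simp: indicator_def ennreal_mult)
        finally show "ennreal ((?u e (x, z))\<^sup>2) * indicator unit_cube x \<le>
          ennreal (h\<^sup>2) * indicator (S j) z * ennreal \<bar>cube_bump N i (\<lambda>_. 0) x\<bar>" .
      qed
      also have "\<dots> = ennreal (h\<^sup>2) * indicator (S j) z * ennreal ((bump_mass / real N) ^ ?dx)"
        by (subst nn_integral_cmult) (simp_all add: nn_integral_abs_cube_bump[OF NK(1)] nn_integral_abs_cube_bump[OF NK(2)])
      also have "\<dots> = ennreal (h\<^sup>2 * (bump_mass / real N) ^ ?dx) * indicator (S j) z"
        using \<kappa> by (simp add: ennreal_mult mult_ac)
      finally show "(\<integral>\<^sup>+x\<in>unit_cube. ennreal ((?u e (x, z))\<^sup>2) \<partial>lborel) * w z \<le>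
          ennreal (h\<^sup>2 * (bump_mass / real N) ^ ?dx) * (w z * indicator (S j) z)"
        by (metis (no_types, lifting) mult.assoc mult.commute mult_right_mono zero_le)
    qed
    also have "\<dots> = ennreal (h\<^sup>2 * (bump_mass / real N) ^ ?dx) * \<mu> j"
      unfolding \<mu>_def by (rule nn_integral_cmult) measurable
    finally have "of_nat n * (\<integral>\<^sup>+t. ennreal ((?u e t)\<^sup>2) \<partial>?P) \<le> of_nat n *
        (ennreal (h\<^sup>2 * (bump_mass / real N) ^ ?dx) * \<mu> j)"
      by (intro mult_left_mono) auto
    also have "\<dots> = ennreal (real n * (h\<^sup>2 * (bump_mass / real N) ^ ?dx)) * \<mu> j"
      using \<kappa> by (simp add: ennreal_mult ennreal_of_nat_eq_real_of_nat mult.assoc)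
    also have "\<dots> \<le> ennreal (real K ^ ?dz / 2) * \<mu> j"
    proof (intro mult_right_mono ennreal_leI)
      have "(bump_mass / real N) ^ ?dx \<le> (1 / real N) ^ ?dx"
        using bump_mass_le_1 \<kappa> NK by (intro power_mono divide_right_mono) auto
      then have "real n * (h\<^sup>2 * (bump_mass / real N) ^ ?dx) \<le> real n * (h\<^sup>2 * (1 / real N) ^ ?dx)"
        by (intro mult_left_mono) auto
      also have "\<dots> \<le> real K ^ ?dz / 2"
        using hn NK by (simp add: power_one_over field_simps)
      finally show "real n * (h\<^sup>2 * (bump_mass / real N) ^ ?dx) \<le> real K ^ ?dz / 2" .
    qed simp
    also have "\<dots> = ennreal (1 / 2) * (ennreal (real K ^ ?dz) * \<mu> j)"
      unfolding mult.assoc[symmetric] by (subst ennreal_mult[symmetric]) auto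
    also have "\<dots> \<le> ennreal (1 / 2) * 2" using Kmu by (intro mult_left_mono) auto
    also have "\<dots> = ennreal (1 / 2) * ennreal 2" by simp
    also have "\<dots> = 1" by (subst ennreal_mult[symmetric]) auto
    finally show ?thesis .
  qed
  have sep: "ennreal \<delta> \<le> (\<integral>\<^sup>+t. ennreal \<bar>?u e t\<bar> \<partial>?P)" if "e \<in> E" for e
  proof -
    obtain i j where e: "e = (i, j)" and i: "i \<in> grid N" and j: "j \<in> grid K"
      using \<open>e \<in> E\<close> J_grid by (auto simp: E_def)
    have "ennreal \<delta> = ennreal (h * c * (bump_mass / real N) ^ ?dx) *
        ennreal ((bump_mass / real K) ^ ?dz)"
      using h c \<kappa> by (simp add: \<delta>_def ennreal_mult)
    also have "\<dots> = (\<integral>\<^sup>+z. ennreal (h * c * (bump_mass / real N) ^ ?dx) *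
        ennreal \<bar>cube_bump K j (\<lambda>_. 0) (z :: real ^ 'dz)\<bar> \<partial>lborel)"
      by (subst nn_integral_cmult) (simp_all add: nn_integral_abs_cube_bump[OF NK(1)] nn_integral_abs_cube_bump[OF NK(2)])
    also have "\<dots> \<le> (\<integral>\<^sup>+z. (\<integral>\<^sup>+x\<in>unit_cube. ennreal \<bar>?u e (x, z)\<bar> \<partial>lborel) * w z \<partial>lborel)"
    proof (intro nn_integral_mono)
      fix z :: "real ^ 'dz"
      show "ennreal (h * c * (bump_mass / real N) ^ ?dx) * ennreal \<bar>cube_bump K j (\<lambda>_. 0) z\<bar> \<le>
          (\<integral>\<^sup>+x\<in>unit_cube. ennreal \<bar>?u e (x, z)\<bar> \<partial>lborel) * w z"
      proof (cases "cube_bump K j (\<lambda>_. 0) z = 0")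
        case False
        then have z: "z \<in> unit_cube" using grid_lt[OF j] by (rule cube_bump_support)
        have "(\<integral>\<^sup>+x\<in>unit_cube. ennreal \<bar>?u e (x, z)\<bar> \<partial>lborel) =
            (\<integral>\<^sup>+x. ennreal (h * \<bar>cube_bump K j (\<lambda>_. 0) z\<bar>) * ennreal \<bar>cube_bump N i (\<lambda>_. 0) (x :: real ^ 'dx)\<bar> \<partial>lborel)"
        proof (intro nn_integral_cong)
          fix x :: "real ^ 'dx"
          show "ennreal \<bar>?u e (x, z)\<bar> * indicator unit_cube x =
              ennreal (h * \<bar>cube_bump K j (\<lambda>_. 0) z\<bar>) * ennreal \<bar>cube_bump N i (\<lambda>_. 0) x\<bar>"
          proof (cases "cube_bump N i (\<lambda>_. 0) x = 0")
            case False
            then have "x \<in> unit_cube" using grid_lt[OF i] by (rule cube_bump_support)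
            then show ?thesis using h by (simp add: e cell_pert_def abs_mult mult_ac flip: ennreal_mult)
          qed (simp add: e cell_pert_def)
        qed
        also have "\<dots> = ennreal (h * \<bar>cube_bump K j (\<lambda>_. 0) z\<bar>) * ennreal ((bump_mass / real N) ^ ?dx)"
          by (subst nn_integral_cmult) (simp_all add: nn_integral_abs_cube_bump[OF NK(1)] nn_integral_abs_cube_bump[OF NK(2)])
        finally have *: "(\<integral>\<^sup>+x\<in>unit_cube. ennreal \<bar>?u e (x, z)\<bar> \<partial>lborel) =
            ennreal (h * \<bar>cube_bump K j (\<lambda>_. 0) z\<bar>) * ennreal ((bump_mass / real N) ^ ?dx)" .
        have "ennreal (h * c * (bump_mass / real N) ^ ?dx) * ennreal \<bar>cube_bump K j (\<lambda>_. 0) z\<bar> =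
            ennreal (h * \<bar>cube_bump K j (\<lambda>_. 0) z\<bar>) * ennreal ((bump_mass / real N) ^ ?dx) * ennreal c"
          using h c \<kappa> by (simp add: mult_ac flip: ennreal_mult)
        also have "\<dots> \<le> ennreal (h * \<bar>cube_bump K j (\<lambda>_. 0) z\<bar>) * ennreal ((bump_mass / real N) ^ ?dx) *
            w z"
          using c(2)[OF z] z by (intro mult_left_mono) (auto simp: w_def intro: ennreal_leI)
        finally show ?thesis by (simp only: *)
      qed simp
    qed
    also have "\<dots> = (\<integral>\<^sup>+t. ennreal \<bar>?u e t\<bar> \<partial>?P)"
      unfolding w_def by (rule nn_integral_base_law[OF p, symmetric]) measurable
    finally show ?thesis .
  qed
  have mass: "(\<integral>\<^sup>+t. ennreal (perturbed ?u A t) \<partial>?P) = 1" if "A \<subseteq> E" for A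
  proof -
    have A: "i k < N" if "(i, j) \<in> A" for i j k using \<open>A \<subseteq> E\<close> that by (auto simp: E_def grid_lt)
    have "(\<integral>\<^sup>+x\<in>unit_cube. ennreal (perturbed ?u A (x, z)) \<partial>lborel) = 1" for z
      by (rule perturbed_nn_integral[OF h NK(1)]) (rule A)
    then show ?thesis
      using prob_density_weight(2)[OF p] by (subst nn_integral_base_law[OF p]) simp_all
  qed
  obtain A where A: "A \<subseteq> E" and "of_nat (card E) * ennreal \<delta> \<le> 16 *
      (\<integral>\<^sup>+s. (\<integral>\<^sup>+t. ennreal \<bar>p_hat s (fst t) (snd t) - perturbed ?u A t\<bar> \<partial>?P)
        \<partial>(\<Pi>\<^sub>M i\<in>{..<n}. density ?P (\<lambda>t. ennreal (perturbed ?u A t))))"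
  proof -
    have "\<exists>A\<subseteq>E. of_nat (card E) * ennreal \<delta> \<le> 16 *
      (\<integral>\<^sup>+s. (\<integral>\<^sup>+t. ennreal \<bar>p_hat s (fst t) (snd t) - perturbed ?u A t\<bar> \<partial>?P)
        \<partial>(\<Pi>\<^sub>M i\<in>{..<n}. density ?P (\<lambda>t. ennreal (perturbed ?u A t))))"
    proof (rule assouad_perturbed_density[OF prob_space_base_law[OF p] E_fin n])
      show "\<bar>?u e t\<bar> \<le> 1/2" for e t using cell_pert_bound[OF h(1), of N K e t] h(2) by linarith
      show "?u e t = 0 \<or> ?u e' t = 0" if "e \<noteq> e'" for e e' t using that by (rule cell_pert_disjoint)
    qed (rule u_meas mass chi sep estimator_measurable[OF p_hat]; assumption)+
    then show ?thesis using that by blast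
  qed
  moreover have "risk n p_hat (\<lambda>x z. perturbed ?u A (x, z)) p =
    (\<integral>\<^sup>+s. (\<integral>\<^sup>+t. ennreal \<bar>p_hat s (fst t) (snd t) - perturbed ?u A t\<bar> \<partial>?P)
        \<partial>(\<Pi>\<^sub>M i\<in>{..<n}. density ?P (\<lambda>t. ennreal (perturbed ?u A t))))"
  proof (rule risk_eq[OF p p_hat])
    show "0 \<le> perturbed ?u A t" for t using perturbed_ge_half[OF h, of N K A t] by linarith
  qed measurable
  ultimately have R: "of_nat (card E) * ennreal \<delta> \<le> 16 * risk n p_hat (\<lambda>x z. perturbed ?u A (x, z)) p"
    by simp
  let ?C = "h * c * bump_mass ^ ?dx * bump_mass ^ ?dz"
  have \<delta>0: "0 \<le> \<delta>" using h c \<kappa> by (simp add: \<delta>_def)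
  have "16 * ennreal (?C / 32) = ennreal (16 * (?C / 32))"
    using h c \<kappa> by (subst ennreal_mult) auto
  also have "\<dots> \<le> ennreal (real (card E) * \<delta>)"
  proof (rule ennreal_leI)
    have "real (K ^ ?dz) \<le> real (2 * card J)" using J_card by (simp only: of_nat_le_iff)
    then have J': "real K ^ ?dz \<le> 2 * real (card J)" by simp
    have "real (N ^ ?dx * K ^ ?dz) * \<delta> = ?C"
      using NK by (simp add: \<delta>_def power_divide)
    then have "?C \<le> (real N ^ ?dx * (2 * real (card J))) * \<delta>"
      using mult_right_mono[OF mult_left_mono[OF J', of "real N ^ ?dx"] \<delta>0] by simp
    then show "16 * (?C / 32) \<le> real (card E) * \<delta>" by (simp add: E_card mult_ac)
  qed
  also have "\<dots> = of_nat (card E) * ennreal \<delta>" using \<delta>0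
      by (simp add: ennreal_mult ennreal_of_nat_eq_real_of_nat)
  also note R
  finally have "16 * ennreal (?C / 32) \<le> 16 * risk n p_hat (\<lambda>x z. perturbed ?u A (x, z)) p" .
  then have "ennreal (?C / 32) \<le> risk n p_hat (\<lambda>x z. perturbed ?u A (x, z)) p"
    by (subst (asm) ennreal_mult_le_mult_iff) auto
  then show ?thesis using A E_sub by blast
qed

end

theorem theorem4p1:
  fixes \<beta> \<gamma> W\<^sub>1 :: real
  assumes "\<beta> > 0" and "0 < \<gamma>" and "\<gamma> \<le> 1" and "W\<^sub>1 > 0"
  shows "\<exists>W\<^sub>0>0. \<forall>W\<^sub>2\<ge>W\<^sub>0. \<forall>c>0. \<exists>C>0.
    \<forall>p\<^sub>Z :: real ^ 'dz \<Rightarrow> real.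
      prob_density_on unit_cube p\<^sub>Z \<and> (\<forall>z\<in>unit_cube. p\<^sub>Z z \<ge> c) \<longrightarrow>
      (\<forall>n\<ge>1.
        (INF p_hat \<in> (estimators n :: ('dx::finite, 'dz::finite) estimator set).
           SUP q \<in> {q. (q, p\<^sub>Z) \<in> smooth_class \<beta> \<gamma> W\<^sub>1 W\<^sub>2}. risk n p_hat q p\<^sub>Z)
        \<ge> ennreal (C * real n powr
             (- 1 / (inverse \<beta> * real CARD('dx) + inverse \<gamma> * real CARD('dz) + 2))))"
proof -
  obtain b where "bump_tower b (strict_floor \<beta>)" using bump_tower_exists by blast
  then interpret bump_tower b "strict_floor \<beta>" .
  \<comment> \<open>The bound \<open>1/8\<close> keeps the densities above \<open>1/2\<close> and serves their indistinguishability and the total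
    variation condition with \<open>W\<^sub>0 = 1\<close>; the bound \<open>W\<^sub>1 / 4\<close> is for the Hoelder condition.\<close>
  define a where "a = min (1/8) (W\<^sub>1 / 4)"
  have a: "0 < a" "a \<le> 1/8" "4 * a \<le> W\<^sub>1" using \<open>W\<^sub>1 > 0\<close> by (auto simp: a_def)
  let ?D = "inverse \<beta> * real CARD('dx) + inverse \<gamma> * real CARD('dz) + 2"
  show ?thesis
  proof (rule exI[of _ "1::real"], intro conjI allI impI)
    fix W\<^sub>2 c :: real
    assume W2: "1 \<le> W\<^sub>2" and c: "0 < c"
    define C where "C = a * 2 powr - \<beta> * c * bump_mass ^ CARD('dx) * bump_mass ^ CARD('dz) / 32"
    have "\<forall>p\<^sub>Z :: real ^ 'dz \<Rightarrow> real. prob_density_on unit_cube p\<^sub>Z \<and> (\<forall>z\<in>unit_cube. p\<^sub>Z z \<ge> c) \<longrightarrow>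
      (\<forall>n\<ge>1. (INF p_hat \<in> (estimators n :: ('dx::finite, 'dz::finite) estimator set).
           SUP q \<in> {q. (q, p\<^sub>Z) \<in> smooth_class \<beta> \<gamma> W\<^sub>1 W\<^sub>2}. risk n p_hat q p\<^sub>Z)
        \<ge> ennreal (C * real n powr (- 1 / ?D)))"
    proof (intro allI impI INF_greatest)
      fix p :: "real ^ 'dz \<Rightarrow> real" and n :: nat and p_hat :: "('dx, 'dz) estimator"
      assume p: "prob_density_on unit_cube p \<and> (\<forall>z\<in>unit_cube. p z \<ge> c)" and n: "1 \<le> n"
        and p_hat: "p_hat \<in> estimators n"
      obtain N K :: nat where NK: "1 \<le> N" "1 \<le> K"
        and tv: "real N powr - \<beta> * real K powr \<gamma> \<le> 2"
        and chi: "real n * (real N powr - \<beta>)\<^sup>2 \<le> real N ^ CARD('dx) * real K ^ CARD('dz)"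
        and rate: "2 powr - \<beta> * real n powr (- 1 / ?D) \<le> real N powr - \<beta>"
        using grid_sizes_exist[OF assms(1-3) n, of "CARD('dx)" "CARD('dz)"] by metis
      define h where "h = a * real N powr - \<beta>"
      have Nb: "real N powr - \<beta> \<le> 1"
        using NK(1) \<open>\<beta> > 0\<close> by (simp add: powr_minus ge_one_powr_ge_zero inverse_le_1_iff)
      have h: "0 \<le> h" "h \<le> 1/2"
        using a mult_mono[of a "1/8" "real N powr - \<beta>" 1] Nb by (auto simp: h_def)
      have "h\<^sup>2 * 2 \<le> (real N powr - \<beta>)\<^sup>2"
      proof -
        have "a\<^sup>2 \<le> (1/8)\<^sup>2" using a by (intro power_mono) auto
        then have "a\<^sup>2 * 2 \<le> 1" by (simp add: power2_eq_square)
        then have "(a\<^sup>2 * 2) * (real N powr - \<beta>)\<^sup>2 \<le> 1 * (real N powr - \<beta>)\<^sup>2"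
          by (rule mult_right_mono) simp
        then show ?thesis by (simp add: h_def power_mult_distrib mult_ac)
      qed
      then have "real n * (h\<^sup>2 * 2) \<le> real n * (real N powr - \<beta>)\<^sup>2" by (rule mult_left_mono) simp
      then have hn: "real n * h\<^sup>2 * 2 \<le> real N ^ CARD('dx) * real K ^ CARD('dz)"
        using chi by (simp add: mult.assoc)
      obtain A :: "(('dx \<Rightarrow> nat) \<times> ('dz \<Rightarrow> nat)) set" where A: "A \<subseteq> grid N \<times> grid K"
        and R: "ennreal (h * c * bump_mass ^ CARD('dx) * bump_mass ^ CARD('dz) / 32) \<le>
          risk n p_hat (\<lambda>x z. perturbed (cell_pert h N K) A (x, z)) p"
        using risk_lower_bound[OF _ c _ h NK n hn p_hat, of p] p by auto
      have "h * real N powr \<beta> = a"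
        using NK(1) by (simp add: h_def powr_minus)
      then have W1: "4 * h * real N powr \<beta> \<le> W\<^sub>1" using a by simp
      have "4 * h * real K powr \<gamma> = 4 * a * (real N powr - \<beta> * real K powr \<gamma>)" by (simp add: h_def)
      also have "\<dots> \<le> 4 * a * 2" using tv a by (intro mult_left_mono) auto
      also have "\<dots> \<le> W\<^sub>2" using a W2 by simp
      finally have W2': "4 * h * real K powr \<gamma> \<le> W\<^sub>2" .
      have A_lt: "i k < N" if "(i, j) \<in> A" for i j k using A that by (auto simp: grid_lt)
      have mem: "((\<lambda>x z. perturbed (cell_pert h N K) A (x, z)), p) \<in> smooth_class \<beta> \<gamma> W\<^sub>1 W\<^sub>2"
        unfolding smooth_class_def mem_Collect_eq case_prod_conv
        using p perturbed_holder_smooth[OF h(1) \<open>\<beta> > 0\<close> order_refl W1 NK(1)]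
          perturbed_tv_smooth[OF h(1) assms(2,3) W2'] perturbed_conditional_density[OF h NK(1), of A K] A_lt
        by auto
      have "C * real n powr (- 1 / ?D) =
          (2 powr - \<beta> * real n powr (- 1 / ?D)) * (a * c * bump_mass ^ CARD('dx) * bump_mass ^ CARD('dz) / 32)"
        by (simp add: C_def)
      also have "\<dots> \<le> real N powr - \<beta> * (a * c * bump_mass ^ CARD('dx) * bump_mass ^ CARD('dz) / 32)"
        using rate a c bump_mass_pos by (intro mult_right_mono) auto
      also have "\<dots> = h * c * bump_mass ^ CARD('dx) * bump_mass ^ CARD('dz) / 32"
        by (simp add: h_def)
      finally have "ennreal (C * real n powr (- 1 / ?D)) \<le>
          risk n p_hat (\<lambda>x z. perturbed (cell_pert h N K) A (x, z)) p"
        using R by (meson ennreal_leI order_trans)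
      then show "ennreal (C * real n powr (- 1 / ?D)) \<le>
          (SUP q \<in> {q. (q, p) \<in> smooth_class \<beta> \<gamma> W\<^sub>1 W\<^sub>2}. risk n p_hat q p)"
        using mem by (intro SUP_upper2[where i="\<lambda>x z. perturbed (cell_pert h N K) A (x, z)"]) auto
    qed
    moreover have "0 < C" using a c bump_mass_pos by (simp add: C_def)
    ultimately show "\<exists>C>0. \<forall>p\<^sub>Z :: real ^ 'dz \<Rightarrow> real. prob_density_on unit_cube p\<^sub>Z \<and>
        (\<forall>z\<in>unit_cube. p\<^sub>Z z \<ge> c) \<longrightarrow>
      (\<forall>n\<ge>1. (INF p_hat \<in> (estimators n :: ('dx::finite, 'dz::finite) estimator set).
           SUP q \<in> {q. (q, p\<^sub>Z) \<in> smooth_class \<beta> \<gamma> W\<^sub>1 W\<^sub>2}. risk n p_hat q p\<^sub>Z)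
        \<ge> ennreal (C * real n powr (- 1 / ?D)))" by blast
  qed simp
qed

end
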